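(* For a positive integer $k$ let $\sigma(k)=\sum_{d\mid k} d$ denote the sum of the positive divisors of $k$, and for a positive integer $n$ define \[ F(n)=\sum_{k=1}^{n} k\,\sigma(k)\,(k^2-3n+2)(2k^2-n)\binom{2n}{n-k}. \] Then for every integer $n\geq 10000$, \[ \left|\frac{F(n)}{\binom{2n}{n}}-\left(-\frac{n^2}{8}+\frac{n}{24}\right)\right|\leq \frac{38755553}{5000}\, n^{3/4}. \]
   Context: In the paper this is written as $F(n)=\binom{2n}{n}\big(-\frac{n^2}{8}+\frac{n}{24}+B_{n\geq N}(\frac{38755553}{5000}n^{3/4})\big)$ with $N=10000$, where a $B$-term $B_{n\geq N}(f(n))$ denotes an unspecified quantity whose absolute value is at most $f(n)$ for all $n\geq N$. *)

theory Defs
  imports "HOL-Analysis.Analysis"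
begin

definition sigma :: "nat \<Rightarrow> nat" where
  "sigma k = (\<Sum>d | d dvd k. d)"

definition F :: "nat \<Rightarrow> int" where
  "F n = (\<Sum>k=1..n. int k * int (sigma k) * ((int k)\<^sup>2 - 3 * int n + 2)
            * (2 * (int k)\<^sup>2 - int n) * int ((2 * n) choose (n - k)))"

end

theory Submission
  imports Defs
begin

text \<open>
  Let \<open>g k = k (k\<^sup>2 - 3n + 2) (2k\<^sup>2 - n) binomial(2n, n + \<bar>k\<bar>)\<close> for integers \<open>\<bar>k\<bar> \<le> n\<close> and
  \<open>G s = \<Sum> g k e\<^sup>k\<^sup>s\<close>. Since \<open>\<Sum> g k = 0\<close> and \<open>\<Sum> k g k = 0\<close> (sums over \<open>k \<ge> 0\<close>), \<open>F n\<close> is the mean of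
  \<open>A s * G s\<close> over the vertical segment \<open>s = e + i t\<close>, \<open>\<bar>t\<bar> \<le> \<pi>\<close>, where
  \<open>A s = \<Sum> (\<sigma>(k) - \<pi>\<^sup>2 k / 6 + 1/2) e\<^sup>-\<^sup>k\<^sup>s\<close> and \<open>e > 0\<close> is arbitrary. The transformation law of the
  Eisenstein series of weight 2 gives \<open>\<Sum> \<sigma>(k) e\<^sup>-\<^sup>k\<^sup>s = \<pi>\<^sup>2/(6s\<^sup>2) - 1/(2s) + 1/24\<close> up to a term which is
  negligible for \<open>e = 2 / sqrt n\<close>, and the two subtracted series remove the poles at \<open>s = 0\<close>. What is
  left agrees up to \<open>O(s\<^sup>5)\<close> with a trigonometric polynomial, whose mean against \<open>G\<close> is an explicit
  combination of \<open>g 1\<close> and \<open>g 2\<close> and equals the main term up to a bounded multiple of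
  \<open>binomial(2n, n)\<close>. On the segment, \<open>G\<close> is concentrated at \<open>\<bar>s\<bar> \<approx> 1 / sqrt n\<close>, so the error
  contributes \<open>O(sqrt n binomial(2n, n))\<close>.
\<close>

section \<open>Partial fraction expansions\<close>

lemma Ints_one_minus_iff: "1 - z \<in> \<int> \<longleftrightarrow> (z :: 'a :: ring_1) \<in> \<int>"
  by (metis Ints_1 Ints_diff diff_diff_eq2 add_diff_cancel_left')

lemma sin_pi_times_nonzero:
  fixes z :: complex
  assumes "z \<notin> \<int>"
  shows "sin (of_real pi * z) \<noteq> 0"
  using assms by (subst sin_eq_0) (auto simp: Ints_def mult.commute[of pi])

lemma Digamma_reflection:
  fixes z :: complex
  assumes "z \<notin> \<int>"
  shows "Digamma (1 - z) - Digamma z = of_real pi * cot (of_real pi * z)"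
proof -
  have nonpole: "z \<notin> \<int>\<^sub>\<le>\<^sub>0" "1 - z \<notin> \<int>\<^sub>\<le>\<^sub>0"
    using assms Ints_one_minus_iff[of z] nonpos_Ints_Int by blast+
  define f where "f = (\<lambda>z::complex. rGamma z * rGamma (1 - z))"
  have f_eq: "f = (\<lambda>z. sin (of_real pi * z) / of_real pi)"
    unfolding f_def using rGamma_reflection_complex by auto
  have "(f has_field_derivative f z * (Digamma (1 - z) - Digamma z)) (at z)"
    unfolding f_def using nonpole by (auto intro!: derivative_eq_intros simp: algebra_simps)
  moreover have "(f has_field_derivative cos (of_real pi * z)) (at z)"
    unfolding f_eq by (auto intro!: derivative_eq_intros)
  ultimately have "f z * (Digamma (1 - z) - Digamma z) = cos (of_real pi * z)"
    by (rule DERIV_unique)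
  thus ?thesis
    using sin_pi_times_nonzero[OF assms] by (simp add: f_eq cot_def field_simps)
qed

lemma Polygamma_1_reflection:
  fixes z :: complex
  assumes "z \<notin> \<int>"
  shows "Polygamma 1 (1 - z) + Polygamma 1 z = (of_real pi / sin (of_real pi * z))\<^sup>2"
proof -
  have nonpole: "z \<notin> \<int>\<^sub>\<le>\<^sub>0" "1 - z \<notin> \<int>\<^sub>\<le>\<^sub>0"
    using assms Ints_one_minus_iff[of z] nonpos_Ints_Int by blast+
  have "((\<lambda>z. Digamma (1 - z) - Digamma z) has_field_derivative
      - Polygamma 1 (1 - z) - Polygamma 1 z) (at z)"
    using nonpole by (auto intro!: derivative_eq_intros)
  moreover have "((\<lambda>z. Digamma (1 - z) - Digamma z) has_field_derivative
      - (of_real pi / sin (of_real pi * z))\<^sup>2) (at z)"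
  proof (rule has_field_derivative_transform_within_open)
    show "((\<lambda>z. of_real pi * cot (of_real pi * z)) has_field_derivative
        - (of_real pi / sin (of_real pi * z))\<^sup>2) (at z)"
      using sin_pi_times_nonzero[OF assms]
      by (auto intro!: derivative_eq_intros DERIV_chain'[OF _ DERIV_cot]
          simp: power2_eq_square divide_inverse)
    show "open (- (\<int> :: complex set))"
      using closed_Ints by blast
  qed (use assms in \<open>auto simp: Digamma_reflection\<close>)
  ultimately have "- Polygamma 1 (1 - z) - Polygamma 1 z = - (of_real pi / sin (of_real pi * z))\<^sup>2"
    by (rule DERIV_unique)
  thus ?thesis
    by (simp add: algebra_simps)
qed

lemma sums_pi_cot:
  fixes z :: complex
  assumes "z \<notin> \<int>"
  shows "(\<lambda>m. 1 / (z + of_nat (Suc m)) + 1 / (z - of_nat (Suc m))) sums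
           (of_real pi * cot (of_real pi * z) - 1 / z)"
proof -
  have Digamma_sums: "(\<lambda>k. inverse (of_nat (Suc k)) - inverse (w + of_nat k)) sums
      (Digamma w + euler_mascheroni)" if "w \<noteq> 0" for w :: complex
    using summable_Digamma[OF that] by (simp add: Digamma_def sums_iff)
  have nonzero: "z \<noteq> 0" "z + 1 \<noteq> 0" "1 - z \<noteq> 0"
    using assms by (auto simp: add_eq_0_iff2)
  have "(\<lambda>m. (inverse (of_nat (Suc m)) - inverse (1 - z + of_nat m))
             - (inverse (of_nat (Suc m)) - inverse (z + 1 + of_nat m))) sums
        ((Digamma (1 - z) + euler_mascheroni) - (Digamma (z + 1) + euler_mascheroni))"
    by (intro sums_diff Digamma_sums nonzero)
  moreover have "inverse (1 - z + of_nat m) = - (1 / (z - of_nat (Suc m)))" for m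
    using inverse_minus_eq[of "z - of_nat (Suc m)"] by (simp add: divide_inverse algebra_simps)
  ultimately show ?thesis
    using Digamma_plus1[OF nonzero(1)] Digamma_reflection[OF assms]
    by (simp add: divide_inverse algebra_simps)
qed

lemma sums_pi_over_sin_squared:
  fixes z :: complex
  assumes "z \<notin> \<int>"
  shows "(\<lambda>m. 1 / (z + of_nat (Suc m))\<^sup>2 + 1 / (z - of_nat (Suc m))\<^sup>2) sums
           ((of_real pi / sin (of_real pi * z))\<^sup>2 - 1 / z\<^sup>2)"
proof -
  have Polygamma_sums: "(\<lambda>k. 1 / (w + of_nat k)\<^sup>2) sums Polygamma 1 w" if "w \<noteq> 0" for w :: complex
    using Polygamma_LIMSEQ[of w 1] that by (simp add: numeral_2_eq_2 divide_inverse)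
  have nonzero: "z \<noteq> 0" "1 - z \<noteq> 0"
    using assms by auto
  have "(\<lambda>m. 1 / (z + of_nat (Suc m))\<^sup>2) sums (Polygamma 1 z - 1 / z\<^sup>2)"
    using Polygamma_sums[OF nonzero(1)] by (subst sums_Suc_iff) simp
  moreover have "(\<lambda>m. 1 / (z - of_nat (Suc m))\<^sup>2) sums Polygamma 1 (1 - z)"
    using Polygamma_sums[OF nonzero(2)] power2_commute[of z]
    by (simp add: algebra_simps)
  ultimately show ?thesis
    using sums_add Polygamma_1_reflection[OF assms]
    by (fastforce simp: algebra_simps)
qed

definition half_coth :: "complex \<Rightarrow> complex" where
  "half_coth w = cosh (w / 2) / (2 * sinh (w / 2))"

definition half_csch_sq :: "complex \<Rightarrow> complex" where
  "half_csch_sq w = 1 / (2 * sinh (w / 2))\<^sup>2"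

lemma
  shows half_coth_conv_cot:
      "half_coth (2 * of_real pi * \<i> * z) = of_real pi * cot (of_real pi * z) / (2 * of_real pi * \<i>)"
    and half_csch_sq_conv_sin:
      "half_csch_sq (2 * of_real pi * \<i> * z) = (of_real pi / sin (of_real pi * z))\<^sup>2 / (2 * of_real pi * \<i>)\<^sup>2"
proof -
  have "\<i> * (2 * of_real pi * \<i> * z / 2) = - (of_real pi * z)"
    by (simp add: complex_eq_iff)
  thus "half_coth (2 * of_real pi * \<i> * z) = of_real pi * cot (of_real pi * z) / (2 * of_real pi * \<i>)"
    "half_csch_sq (2 * of_real pi * \<i> * z) = (of_real pi / sin (of_real pi * z))\<^sup>2 / (2 * of_real pi * \<i>)\<^sup>2"
    unfolding half_coth_def half_csch_sq_def sinh_conv_sin cosh_conv_cos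
    by (simp_all only: sin_minus cos_minus) (simp_all add: cot_def power_mult_distrib power_divide)
qed

definition imag_shift :: "complex \<Rightarrow> real \<Rightarrow> complex" where
  "imag_shift w y = w + of_real (2 * pi * y) * \<i>"

lemma Re_imag_shift [simp]: "Re (imag_shift w y) = Re w"
  by (simp add: imag_shift_def)

lemma
  assumes "Re w \<noteq> 0"
  shows sums_half_coth: "(\<lambda>k. 1 / imag_shift w (real (Suc k)) + 1 / imag_shift w (- real (Suc k)))
           sums (half_coth w - 1 / w)"
    and sums_half_csch_sq: "(\<lambda>k. 1 / (imag_shift w (real (Suc k)))\<^sup>2 + 1 / (imag_shift w (- real (Suc k)))\<^sup>2)
           sums (half_csch_sq w - 1 / w\<^sup>2)"
proof -
  define p where "p = 2 * of_real pi * \<i>"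
  define z where "z = w / p"
  have w: "w = p * z"
    by (simp add: z_def p_def)
  have "z \<notin> \<int>"
  proof
    assume "z \<in> \<int>"
    then obtain j where "z = of_int j"
      by (auto elim: Ints_cases)
    with assms show False
      by (simp add: w p_def)
  qed
  have shift: "imag_shift w (real k) = p * (z + of_nat k)"
    "imag_shift w (- real k) = p * (z - of_nat k)" for k
    by (simp_all add: imag_shift_def w p_def algebra_simps)
  show "(\<lambda>k. 1 / imag_shift w (real (Suc k)) + 1 / imag_shift w (- real (Suc k))) sums (half_coth w - 1 / w)"
    using sums_divide[OF sums_pi_cot[OF \<open>z \<notin> \<int>\<close>], of p] half_coth_conv_cot[of z, folded p_def]
    unfolding shift by (simp add: w add_divide_distrib diff_divide_distrib mult.commute del: of_nat_Suc)
  show "(\<lambda>k. 1 / (imag_shift w (real (Suc k)))\<^sup>2 + 1 / (imag_shift w (- real (Suc k)))\<^sup>2)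
      sums (half_csch_sq w - 1 / w\<^sup>2)"
    using sums_divide[OF sums_pi_over_sin_squared[OF \<open>z \<notin> \<int>\<close>], of "p\<^sup>2"]
      half_csch_sq_conv_sin[of z, folded p_def]
    unfolding shift
    by (simp add: w add_divide_distrib diff_divide_distrib power_mult_distrib mult.commute
        del: of_nat_Suc)
qed

section \<open>The generating function of the divisor sum\<close>

lemma power_le_fact_times_exp:
  fixes x :: real
  assumes "x \<ge> 0"
  shows "x ^ k \<le> fact k * exp x"
proof -
  have "(\<Sum>n\<in>{k}. x ^ n /\<^sub>R fact n) \<le> exp x"
    unfolding exp_def by (rule sum_le_suminf[OF summable_exp_generic]) (use assms in auto)
  thus ?thesis
    by (simp add: field_simps)
qed

lemma power_times_exp_minus_le:
  fixes a x :: real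
  assumes "a > 0" "x \<ge> 0"
  shows "x ^ k * exp (- (a * x)) \<le> fact k / a ^ k"
  using power_le_fact_times_exp[of "a * x" k] assms
  by (simp add: exp_minus power_mult_distrib field_simps)

lemma summable_power_times_exp_minus:
  fixes e :: real
  assumes "e > 0"
  shows "summable (\<lambda>k. real k ^ j * exp (- (e * real k)))"
proof (rule summable_comparison_test')
  show "summable (\<lambda>k. fact (j + 2) / e ^ (j + 2) * inverse (real k ^ 2))"
    by (intro summable_mult inverse_power_summable) simp
  show "norm (real k ^ j * exp (- (e * real k))) \<le> fact (j + 2) / e ^ (j + 2) * inverse (real k ^ 2)"
    if "k \<ge> 1" for k
  proof -
    have "real k ^ j * exp (- (e * real k)) = real k ^ (j + 2) * exp (- (e * real k)) * inverse (real k ^ 2)"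
      using that by (simp add: power_add power2_eq_square field_simps)
    also have "\<dots> \<le> fact (j + 2) / e ^ (j + 2) * inverse (real k ^ 2)"
      using assms by (intro mult_right_mono power_times_exp_minus_le) auto
    finally show ?thesis
      by simp
  qed
qed

text \<open>Every number divides \<open>0\<close>, so this is the value of a sum over an infinite set.\<close>

lemma sigma_0: "sigma 0 = 0"
  by (simp add: sigma_def)

lemma sigma_le_square: "sigma k \<le> k\<^sup>2"
proof (cases "k = 0")
  case False
  hence "{d. d dvd k} \<subseteq> {1..k}"
    by (auto intro: dvd_imp_le Nat.gr0I)
  hence "sigma k \<le> (\<Sum>d\<in>{1..k}. k)"
    unfolding sigma_def by (intro sum_le_included[where i = "\<lambda>x. x"]) auto
  thus ?thesis
    by (simp add: power2_eq_square)
qed (simp add: sigma_0)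

lemma summable_sigma_times_exp_minus:
  assumes "e > 0"
  shows "summable (\<lambda>k. real (sigma k) * exp (- (e * real k)))"
proof (rule summable_comparison_test'[OF summable_power_times_exp_minus[OF assms, of 2], of 0])
  show "norm (real (sigma k) * exp (- (e * real k))) \<le> (real k)\<^sup>2 * exp (- (e * real k))" for k
    using sigma_le_square[of k] by (simp flip: of_nat_power)
qed

definition sigma_series :: "complex \<Rightarrow> complex" where
  "sigma_series s = (\<Sum>k. of_nat (sigma k) * exp (- (of_nat k * s)))"

lemma has_sum_reindex_divisors:
  "((\<lambda>(m, d). f m d) has_sum S) ({0<..} \<times> {0<..}) \<longleftrightarrow>
   ((\<lambda>(k, d). f (k div d) d) has_sum S) (SIGMA k:{0::nat<..}. {d. d dvd k})"
  by (rule has_sum_reindex_bij_witness[where i = "\<lambda>(k, d). (k div d, d)" and j = "\<lambda>(m, d). (m * d, d)"])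
    (auto elim!: dvdE)

lemma half_csch_sq_conv_exp: "half_csch_sq w = exp (- w) / (1 - exp (- w))\<^sup>2"
proof -
  have "exp (w / 2) * exp (- w) = exp (- (w / 2))"
    unfolding exp_add[symmetric] by (rule arg_cong[where f = exp]) simp
  hence sinh_eq: "2 * sinh (w / 2) = exp (w / 2) * (1 - exp (- w))"
    by (simp add: sinh_field_def right_diff_distrib)
  have exp_eq: "(exp (w / 2))\<^sup>2 = exp w"
    unfolding exp_of_nat_mult[symmetric] by simp
  show ?thesis
    unfolding half_csch_sq_def sinh_eq power_mult_distrib exp_eq
    by (simp add: exp_minus divide_inverse)
qed

lemma sums_half_csch_sq_exp:
  assumes "Re w > 0"
  shows "(\<lambda>d. of_nat d * exp (- (of_nat d * w))) sums half_csch_sq w"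
proof -
  define q where "q = exp (- w)"
  have "norm q < 1"
    using assms by (simp add: q_def)
  from sums_mult[OF geometric_deriv_sums[OF this], of q]
  have "(\<lambda>d. of_nat (Suc d) * q ^ Suc d) sums half_csch_sq w"
    by (simp add: half_csch_sq_conv_exp q_def mult_ac)
  hence "(\<lambda>d. of_nat d * q ^ d) sums half_csch_sq w"
    using sums_Suc_iff[of "\<lambda>d. of_nat d * q ^ d" "half_csch_sq w"] by simp
  moreover have "q ^ d = exp (- (of_nat d * w))" for d
    unfolding q_def exp_of_nat_mult[symmetric] by simp
  ultimately show ?thesis
    by simp
qed

lemma divisor_pairs_has_sum_sigma_series:
  assumes "Re s > 0"
  shows "((\<lambda>(k, d). of_nat d * exp (- (of_nat k * s))) has_sum sigma_series s)
           (SIGMA k:{0<..}. {d. d dvd k})"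
proof -
  define f where "f = (\<lambda>k (d::nat). of_nat d * exp (- (of_nat k * s)))"
  have norm_f: "norm (f k d) = real d * exp (- (Re s * real k))" for k d
    by (simp add: f_def norm_mult mult.commute)
  have inner_norm: "((\<lambda>d. norm (f k d)) has_sum real (sigma k) * exp (- (Re s * real k))) {d. d dvd k}"
    if "k > 0" for k
    using that by (intro has_sum_finiteI) (simp_all add: norm_f sigma_def sum_distrib_right)
  have inner: "(f k has_sum of_nat (sigma k) * exp (- (of_nat k * s))) {d. d dvd k}"
    if "k > 0" for k
    using that by (intro has_sum_finiteI) (simp_all add: f_def sigma_def sum_distrib_right)
  have outer_norm: "(\<lambda>k. real (sigma k) * exp (- (Re s * real k))) summable_on {0<..}"
    using summable_sigma_times_exp_minus[OF assms]
    by (intro summable_on_subset_banach[OF norm_summable_imp_summable_on]) auto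
  have "(\<lambda>(k, d). norm (f k d)) summable_on (SIGMA k:{0<..}. {d. d dvd k})"
    by (rule summable_on_SigmaI[OF _ outer_norm]) (use inner_norm in auto)
  hence "(\<lambda>(k, d). f k d) summable_on (SIGMA k:{0<..}. {d. d dvd k})"
    unfolding case_prod_unfold by (rule abs_summable_summable)
  then obtain S where S: "((\<lambda>(k, d). f k d) has_sum S) (SIGMA k:{0<..}. {d. d dvd k})"
    unfolding summable_on_def by blast
  have "((\<lambda>k. of_nat (sigma k) * exp (- (of_nat k * s))) has_sum S) {0<..}"
    by (rule has_sum_SigmaD[OF S]) (use inner in auto)
  hence "((\<lambda>k. of_nat (sigma k) * exp (- (of_nat k * s))) has_sum S) UNIV"
    by (rule has_sum_cong_neutral[THEN iffD1, rotated -1]) (auto simp: sigma_0)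
  hence "S = sigma_series s"
    by (auto dest!: has_sum_imp_sums simp: sigma_series_def sums_iff)
  with S show ?thesis
    by (simp add: f_def)
qed

text \<open>Expand \<open>1 / (2 sinh (m s / 2))\<^sup>2 = \<Sum> d e\<^sup>-\<^sup>m\<^sup>d\<^sup>s\<close> and collect the terms with \<open>m d = k\<close>.\<close>

lemma half_csch_sq_sums_sigma_series:
  assumes "Re s > 0"
  shows "(\<lambda>m. half_csch_sq (of_nat (Suc m) * s)) sums sigma_series s"
proof -
  have pairs: "((\<lambda>(m, d). of_nat d * exp (- (of_nat (m * d) * s))) has_sum sigma_series s)
      ({0<..} \<times> {0<..})"
    unfolding has_sum_reindex_divisors
    by (rule has_sum_cong[THEN iffD1, OF _ divisor_pairs_has_sum_sigma_series[OF assms]])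
      (auto simp del: of_nat_mult)
  have "((\<lambda>m. half_csch_sq (of_nat m * s)) has_sum sigma_series s) {0<..}"
  proof (rule has_sum_SigmaD[OF pairs])
    fix m :: nat assume "m \<in> {0<..}"
    define f where "f = (\<lambda>d. of_nat d * exp (- (of_nat (m * d) * s)))"
    have Re_pos: "Re (of_nat m * s) > 0"
      using assms \<open>m \<in> {0<..}\<close> by simp
    have row: "f sums half_csch_sq (of_nat m * s)"
      using sums_half_csch_sq_exp[OF Re_pos] by (simp add: f_def mult_ac)
    have "norm (f d) = real d ^ 1 * exp (- (Re (of_nat m * s) * real d))" for d
      by (simp add: f_def norm_mult mult_ac)
    hence "summable (\<lambda>d. norm (f d))"
      using summable_power_times_exp_minus[OF Re_pos, of 1] by simp
    hence "(f has_sum half_csch_sq (of_nat m * s)) UNIV"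
      using row by (rule norm_summable_imp_has_sum)
    thus "((\<lambda>d. case (m, d) of (m, d) \<Rightarrow> of_nat d * exp (- (of_nat (m * d) * s)))
        has_sum half_csch_sq (of_nat m * s)) {0<..}"
      by (rule has_sum_cong_neutral[THEN iffD1, rotated -1]) (auto simp: f_def)
  qed
  moreover have "bij_betw Suc UNIV {0<..}"
    by (auto simp: bij_betw_def image_iff gr0_conv_Suc)
  ultimately have "((\<lambda>m. half_csch_sq (of_nat (Suc m) * s)) has_sum sigma_series s) UNIV"
    by (subst has_sum_reindex_bij_betw[where g = Suc])
  thus ?thesis
    by (rule has_sum_imp_sums)
qed

section \<open>The transformation law\<close>

lemma norm_imag_shift_ge:
  assumes "Re s > 0"
  obtains c where "c > 0" "\<And>x y. c * norm (Complex x y) \<le> norm (imag_shift (of_real x * s) y)"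
proof -
  define f where "f = (\<lambda>z. of_real (Re z) * s + of_real (2 * pi * Im z) * \<i>)"
  have "linear f"
    by (rule linearI) (simp_all add: f_def scaleR_conv_of_real algebra_simps)
  moreover have "inj f"
  proof (rule linear_injective_0[OF \<open>linear f\<close>, THEN iffD2], intro allI impI)
    fix z assume "f z = 0"
    hence "Re (f z) = 0" "Im (f z) = 0"
      by auto
    thus "z = 0"
      using assms by (auto simp: f_def complex_eq_iff)
  qed
  ultimately obtain c where c: "c > 0" "\<And>z. c * norm z \<le> norm (f z)"
    using linear_inj_bounded_below_pos by blast
  have "c * norm (Complex x y) \<le> norm (imag_shift (of_real x * s) y)" for x y
    using c(2)[of "Complex x y"] by (simp add: f_def imag_shift_def)
  with c(1) show ?thesis
    by (rule that)
qed

definition paired :: "(real \<Rightarrow> 'a::ab_group_add) \<Rightarrow> nat \<Rightarrow> 'a" where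
  "paired f k = (if k = 0 then f 0 else f (real k) + f (- real k))"

lemma paired_diff: "paired (\<lambda>y. f y - g y) k = paired f k - paired g k"
  by (simp add: paired_def)

lemma norm_paired_le:
  fixes f :: "real \<Rightarrow> 'a::real_normed_vector"
  assumes "norm (f (real k)) \<le> B" "norm (f (- real k)) \<le> B"
  shows "norm (paired f k) \<le> 2 * B"
proof (cases "k = 0")
  case True
  have "0 \<le> B"
    using order_trans[OF norm_ge_zero assms(1)] .
  with True assms(1) show ?thesis
    by (simp add: paired_def)
next
  case False
  thus ?thesis
    using order_trans[OF norm_triangle_ineq add_mono[OF assms]] by (simp add: paired_def)
qed

lemma sum_paired_telescope:
  assumes "\<And>y. f y = g (y - 1/2) - g (y + 1/2)"
  shows "(\<Sum>k<Suc N. paired f k) = g (- (real N + 1/2)) - g (real N + 1/2)"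
proof (induction N)
  case 0
  show ?case
    using assms[of 0] by (simp add: paired_def)
next
  case (Suc N)
  have shifts: "real (Suc N) - 1/2 = real N + 1/2" "- real (Suc N) - 1/2 = - (real (Suc N) + 1/2)"
    "- real (Suc N) + 1/2 = - (real N + 1/2)"
    by simp_all
  have "paired f (Suc N) = (g (real N + 1/2) - g (real (Suc N) + 1/2))
      + (g (- (real (Suc N) + 1/2)) - g (- (real N + 1/2)))"
    unfolding paired_def assms shifts by simp
  thus ?case
    unfolding sum.lessThan_Suc[of _ "Suc N"] Suc.IH by simp
qed

lemma paired_inverse_square_sums:
  assumes "Re w > 0"
  shows "paired (\<lambda>y. 1 / (imag_shift w y)\<^sup>2) sums half_csch_sq w"
proof -
  have "(\<lambda>k. paired (\<lambda>y. 1 / (imag_shift w y)\<^sup>2) (Suc k)) sums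
      (half_csch_sq w - paired (\<lambda>y. 1 / (imag_shift w y)\<^sup>2) 0)"
    using sums_half_csch_sq[of w] assms by (simp add: paired_def imag_shift_def)
  thus ?thesis
    by (subst (asm) sums_Suc_iff) simp
qed

text \<open>The double series of \<open>1 / (m s + 2 \<pi> \<i> k)\<^sup>2\<close> converges only conditionally. Subtracting from each
  term its mean over \<open>k - 1/2 \<le> y \<le> k + 1/2\<close>, which is \<open>1 / ((m s + 2 \<pi> \<i> k)\<^sup>2 + \<pi>\<^sup>2)\<close>, makes it absolutely
  convergent. The means sum to \<open>0\<close> over \<open>k\<close> for fixed \<open>m\<close>; summed over \<open>m\<close> first they contribute
  the anomalous term \<open>1 / (2 s)\<close>.\<close>

definition reduced_inverse_square :: "complex \<Rightarrow> complex" where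
  "reduced_inverse_square w = 1 / w\<^sup>2 - 1 / (w\<^sup>2 + of_real pi ^ 2)"

lemma square_plus_pi_square:
  "(imag_shift w y)\<^sup>2 + of_real pi ^ 2 = imag_shift w (y + 1/2) * imag_shift w (y - 1/2)"
  by (simp add: imag_shift_def power2_eq_square algebra_simps)

lemma inverse_square_plus_pi_square:
  assumes "Re w > 0"
  shows "1 / ((imag_shift w y)\<^sup>2 + of_real pi ^ 2)
       = 1 / imag_shift w (y - 1/2) / (2 * of_real pi * \<i>)
         - 1 / imag_shift w (y + 1/2) / (2 * of_real pi * \<i>)"
proof -
  have nonzero: "imag_shift w (y + 1/2) \<noteq> 0" "imag_shift w (y - 1/2) \<noteq> 0"
    using assms Re_imag_shift[of w] by (metis less_irrefl zero_complex.sel(1))+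
  have "imag_shift w (y + 1/2) - imag_shift w (y - 1/2) = 2 * of_real pi * \<i>"
    by (simp add: imag_shift_def algebra_simps)
  hence "1 / imag_shift w (y - 1/2) - 1 / imag_shift w (y + 1/2)
      = 2 * of_real pi * \<i> / (imag_shift w (y + 1/2) * imag_shift w (y - 1/2))"
    using nonzero by (simp add: diff_frac_eq mult.commute)
  thus ?thesis
    unfolding square_plus_pi_square diff_divide_distrib[symmetric] by simp
qed

definition reduced_partial_sum :: "complex \<Rightarrow> nat \<Rightarrow> complex" where
  "reduced_partial_sum w N = (\<Sum>k<N. paired (\<lambda>y. reduced_inverse_square (imag_shift w y)) k)"

lemma reduced_partial_sum_Suc:
  assumes "Re w > 0"
  shows "reduced_partial_sum w (Suc N) = (\<Sum>k<Suc N. paired (\<lambda>y. 1 / (imag_shift w y)\<^sup>2) k)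
         - (1 / imag_shift w (- (real N + 1/2)) - 1 / imag_shift w (real N + 1/2)) / (2 * of_real pi * \<i>)"
  unfolding reduced_partial_sum_def reduced_inverse_square_def paired_diff sum_subtractf
  by (subst sum_paired_telescope[OF inverse_square_plus_pi_square[OF assms]])
    (simp add: diff_divide_distrib)

lemma inverse_imag_shift_tendsto_0:
  assumes "filterlim (\<lambda>N. \<bar>y N\<bar>) at_top G"
  shows "((\<lambda>N. 1 / imag_shift w (y N)) \<longlongrightarrow> 0) G"
proof -
  have "filterlim (\<lambda>N. norm (of_real (2 * pi * y N) * \<i>)) at_top G"
    using filterlim_tendsto_pos_mult_at_top[OF tendsto_const[of "2 * pi"] _ assms]
    by (simp add: norm_mult abs_mult)
  hence "filterlim (\<lambda>N. imag_shift w (y N)) at_infinity G"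
    unfolding imag_shift_def
    by (intro tendsto_add_filterlim_at_infinity[OF tendsto_const] filterlim_norm_at_top_imp_at_infinity)
  thus ?thesis
    unfolding divide_inverse by (simp add: filterlim_compose[OF tendsto_inverse_0])
qed

lemma filterlim_half_integers_at_top: "filterlim (\<lambda>N. real N + 1/2) at_top sequentially"
  by (subst add.commute) (rule filterlim_tendsto_add_at_top[OF tendsto_const filterlim_real_sequentially])

lemma reduced_partial_sum_tendsto:
  assumes "Re w > 0"
  shows "(\<lambda>N. reduced_partial_sum w (Suc N)) \<longlonglongrightarrow> half_csch_sq w"
proof -
  have "\<bar>- (real N + 1/2)\<bar> = real N + 1/2" "\<bar>real N + 1/2\<bar> = real N + 1/2" for N
    by simp_all
  hence boundary: "(\<lambda>N. 1 / imag_shift w (- (real N + 1/2))) \<longlonglongrightarrow> 0"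
    "(\<lambda>N. 1 / imag_shift w (real N + 1/2)) \<longlonglongrightarrow> 0"
    using filterlim_half_integers_at_top by (auto intro!: inverse_imag_shift_tendsto_0 simp only:)
  have "(\<lambda>N. \<Sum>k<Suc N. paired (\<lambda>y. 1 / (imag_shift w y)\<^sup>2) k) \<longlonglongrightarrow> half_csch_sq w"
    using paired_inverse_square_sums[OF assms] LIMSEQ_Suc unfolding sums_def by blast
  hence "(\<lambda>N. reduced_partial_sum w (Suc N)) \<longlonglongrightarrow> half_csch_sq w - (0 - 0) / (2 * of_real pi * \<i>)"
    unfolding reduced_partial_sum_Suc[OF assms] by (intro tendsto_intros boundary) simp_all
  thus ?thesis
    by simp
qed

lemma norm_Complex_le_double_shift:
  assumes "1 \<le> x" "\<bar>h\<bar> \<le> 1/2"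
  shows "norm (Complex x y) \<le> 2 * norm (Complex x (y + h))"
proof -
  have "Complex x (y + h) - Complex 0 h = Complex x y"
    by (simp add: complex_eq_iff)
  hence "norm (Complex x y) \<le> norm (Complex x (y + h)) + norm (Complex 0 h)"
    by (metis norm_triangle_ineq4)
  moreover have "norm (Complex 0 h) \<le> 1/2"
    using assms(2) by (simp add: cmod_def)
  moreover have "1 \<le> norm (Complex x y)"
    using complex_Re_le_cmod[of "Complex x y"] assms(1) by simp
  ultimately show ?thesis
    by linarith
qed

lemma norm_reduced_inverse_square_le:
  assumes "Re s > 0"
  obtains C where "C \<ge> 0" "\<And>x y. x \<ge> 1 \<Longrightarrow>
    norm (reduced_inverse_square (imag_shift (of_real x * s) y)) \<le> C / (x\<^sup>2 * (1 + y\<^sup>2))"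
proof -
  obtain c where c: "c > 0" "\<And>x y. c * norm (Complex x y) \<le> norm (imag_shift (of_real x * s) y)"
    using norm_imag_shift_ge[OF assms] by blast
  have "norm (reduced_inverse_square (imag_shift (of_real x * s) y)) \<le> 4 * pi\<^sup>2 / c ^ 4 / (x\<^sup>2 * (1 + y\<^sup>2))"
    if x: "x \<ge> 1" for x y
  proof -
    define w where "w = imag_shift (of_real x * s) y"
    define \<rho> where "\<rho> = norm (Complex x y)"
    have \<rho>_sq: "\<rho>\<^sup>2 = x\<^sup>2 + y\<^sup>2" "1 \<le> x\<^sup>2"
      using x by (simp_all add: \<rho>_def cmod_power2)
    hence "\<rho> > 0"
      using x by (auto simp: \<rho>_def complex_eq_iff)
    have shift_ge: "c * (\<rho> / 2) \<le> norm (imag_shift (of_real x * s) (y + h))" if "\<bar>h\<bar> \<le> 1/2" for h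
      using norm_Complex_le_double_shift[OF x that, of y] c(1) unfolding \<rho>_def
      by (intro order_trans[OF mult_left_mono c(2)]) auto
    have "(c * (\<rho> / 2)) * (c * (\<rho> / 2))
        \<le> norm (imag_shift (of_real x * s) (y + 1/2)) * norm (imag_shift (of_real x * s) (y - 1/2))"
      using shift_ge[of "1/2"] shift_ge[of "-1/2"] c(1) \<open>\<rho> > 0\<close> by (intro mult_mono) auto
    hence norm_plus_ge: "(c * (\<rho> / 2))\<^sup>2 \<le> norm (w\<^sup>2 + of_real pi ^ 2)"
      unfolding w_def square_plus_pi_square norm_mult by (simp only: power2_eq_square)
    have norm_ge: "(c * \<rho>)\<^sup>2 \<le> norm (w\<^sup>2)"
      unfolding norm_power w_def \<rho>_def using c by (intro power_mono) auto
    have pos: "0 < (c * \<rho>)\<^sup>2" "0 < (c * (\<rho> / 2))\<^sup>2"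
      using c(1) \<open>\<rho> > 0\<close> by auto
    have "w\<^sup>2 \<noteq> 0" "w\<^sup>2 + of_real pi ^ 2 \<noteq> 0"
      using pos norm_ge norm_plus_ge by auto
    hence "norm (reduced_inverse_square w) = pi\<^sup>2 / (norm (w\<^sup>2) * norm (w\<^sup>2 + of_real pi ^ 2))"
      by (simp add: reduced_inverse_square_def diff_frac_eq norm_divide norm_mult norm_power)
    also have "\<dots> \<le> pi\<^sup>2 / ((c * \<rho>)\<^sup>2 * (c * (\<rho> / 2))\<^sup>2)"
      using pos norm_ge norm_plus_ge by (intro divide_left_mono mult_mono mult_pos_pos) auto
    also have "\<dots> = 4 * pi\<^sup>2 / c ^ 4 / (\<rho>\<^sup>2 * \<rho>\<^sup>2)"
      by (simp add: power_mult_distrib power_divide power2_eq_square power4_eq_xxxx mult_ac)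
    also have "\<dots> \<le> 4 * pi\<^sup>2 / c ^ 4 / (x\<^sup>2 * (1 + y\<^sup>2))"
      using \<rho>_sq x by (intro divide_left_mono mult_mono mult_pos_pos) (auto simp: add_pos_nonneg)
    finally show ?thesis
      by (simp add: w_def)
  qed
  thus ?thesis
    using that[of "4 * pi\<^sup>2 / c ^ 4"] c(1) by simp
qed

lemma norm_reduced_partial_sum_le:
  assumes "Re s > 0"
  obtains K where "\<And>x N. x \<ge> 1 \<Longrightarrow> norm (reduced_partial_sum (of_real x * s) N) \<le> K / x\<^sup>2"
proof -
  obtain C where C: "C \<ge> 0" "\<And>x y. x \<ge> 1 \<Longrightarrow>
      norm (reduced_inverse_square (imag_shift (of_real x * s) y)) \<le> C / (x\<^sup>2 * (1 + y\<^sup>2))"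
    using norm_reduced_inverse_square_le[OF assms] by blast
  define b where "b = (\<lambda>k. 1 / (1 + (real k)\<^sup>2))"
  have "summable (\<lambda>k. inverse (real k ^ 2))"
    by (rule inverse_power_summable) simp
  moreover have "norm (b k) \<le> inverse (real k ^ 2)" if "k \<ge> 1" for k
    using that by (auto simp: b_def divide_inverse intro!: le_imp_inverse_le)
  ultimately have summable_b: "summable b"
    by (rule summable_comparison_test')
  have "norm (reduced_partial_sum (of_real x * s) N) \<le> 2 * C * suminf b / x\<^sup>2" if "x \<ge> 1" for x N
  proof -
    have "norm (paired (\<lambda>y. reduced_inverse_square (imag_shift (of_real x * s) y)) k)
        \<le> 2 * C / x\<^sup>2 * b k" for k
      using norm_paired_le[of "\<lambda>y. reduced_inverse_square (imag_shift (of_real x * s) y)" k "C / x\<^sup>2 * b k"]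
        C(2)[OF that, of "real k"] C(2)[OF that, of "- real k"] by (simp add: b_def)
    hence "norm (reduced_partial_sum (of_real x * s) N) \<le> (\<Sum>k<N. 2 * C / x\<^sup>2 * b k)"
      unfolding reduced_partial_sum_def by (rule sum_norm_le)
    also have "\<dots> \<le> 2 * C / x\<^sup>2 * suminf b"
      unfolding sum_distrib_left[symmetric]
      using sum_le_suminf[OF summable_b, of "{..<N}"] C(1) by (intro mult_left_mono) (auto simp: b_def)
    finally show ?thesis
      by simp
  qed
  thus ?thesis
    using that by blast
qed

lemma imag_shift_dual:
  assumes "s \<noteq> 0"
  shows "imag_shift (of_real (4 * pi\<^sup>2 * y) / s) x
       = 2 * of_real pi * \<i> / s * imag_shift (of_real x * s) (- y)"
  using assms by (simp add: imag_shift_def field_simps power2_eq_square)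

lemma imag_shift_minus: "imag_shift (- w) (- y) = - imag_shift w y"
  by (simp add: imag_shift_def)

lemma column_sums_inverse_square:
  assumes "Re s > 0" "y > 0"
  shows "(\<lambda>m. 1 / (imag_shift (of_nat (Suc m) * s) y)\<^sup>2 + 1 / (imag_shift (of_nat (Suc m) * s) (- y))\<^sup>2) sums
           (of_real (1 / (4 * pi\<^sup>2 * y\<^sup>2))
            - 4 * of_real pi ^ 2 / s\<^sup>2 * half_csch_sq (of_real (4 * pi\<^sup>2 * y) / s))"
proof -
  have "s \<noteq> 0"
    using assms(1) by auto
  define w where "w = of_real (4 * pi\<^sup>2 * y) / s"
  have "Re w \<noteq> 0"
    using assms \<open>s \<noteq> 0\<close> by (simp add: w_def Re_divide)
  define q where "q = 2 * of_real pi * \<i> / s"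
  have "q \<noteq> 0" and q_sq: "q\<^sup>2 = - (4 * of_real pi ^ 2 / s\<^sup>2)"
    using \<open>s \<noteq> 0\<close> by (simp_all add: q_def power_divide power_mult_distrib)
  from sums_mult[OF sums_half_csch_sq[OF \<open>Re w \<noteq> 0\<close>], of "q\<^sup>2"]
  have "(\<lambda>m. 1 / (imag_shift (of_nat (Suc m) * s) y)\<^sup>2 + 1 / (imag_shift (of_nat (Suc m) * s) (- y))\<^sup>2) sums
      (q\<^sup>2 * (half_csch_sq w - 1 / w\<^sup>2))"
    unfolding w_def imag_shift_dual[OF \<open>s \<noteq> 0\<close>] unfolding q_def[symmetric]
    using \<open>q \<noteq> 0\<close> imag_shift_minus[of "of_nat (Suc _) * s" y]
    by (simp add: power_mult_distrib distrib_left add.commute del: of_nat_Suc)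
  moreover have "q\<^sup>2 / w\<^sup>2 = - of_real (1 / (4 * pi\<^sup>2 * y\<^sup>2))"
    using \<open>s \<noteq> 0\<close> assms(2) by (simp add: q_sq w_def power_divide power_mult_distrib field_simps)
  ultimately show ?thesis
    unfolding w_def[symmetric] by (simp add: right_diff_distrib q_sq)
qed

lemma column_sums_inverse:
  assumes "Re s > 0" "y > 0"
  shows "(\<lambda>m. 1 / imag_shift (of_nat (Suc m) * s) (- y) - 1 / imag_shift (of_nat (Suc m) * s) y) sums
           (2 * of_real pi * \<i> / s * half_coth (of_real (4 * pi\<^sup>2 * y) / s) - \<i> / of_real (2 * pi * y))"
proof -
  have "s \<noteq> 0"
    using assms(1) by auto
  define w where "w = of_real (4 * pi\<^sup>2 * y) / s"
  have "Re w \<noteq> 0"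
    using assms \<open>s \<noteq> 0\<close> by (simp add: w_def Re_divide)
  define q where "q = 2 * of_real pi * \<i> / s"
  have "q \<noteq> 0"
    using \<open>s \<noteq> 0\<close> by (simp add: q_def)
  from sums_mult[OF sums_half_coth[OF \<open>Re w \<noteq> 0\<close>], of q]
  have "(\<lambda>m. 1 / imag_shift (of_nat (Suc m) * s) (- y) - 1 / imag_shift (of_nat (Suc m) * s) y) sums
      (q * (half_coth w - 1 / w))"
    unfolding w_def imag_shift_dual[OF \<open>s \<noteq> 0\<close>] unfolding q_def[symmetric]
    using \<open>q \<noteq> 0\<close> imag_shift_minus[of "of_nat (Suc _) * s" y]
    by (simp add: right_diff_distrib del: of_nat_Suc)
  moreover have "q / w = \<i> / of_real (2 * pi * y)"
    using \<open>s \<noteq> 0\<close> assms(2) by (simp add: q_def w_def field_simps power2_eq_square)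
  ultimately show ?thesis
    unfolding q_def[symmetric] w_def[symmetric] by (simp add: right_diff_distrib)
qed

lemma half_coth_conv_exp:
  assumes "exp (- w) \<noteq> 1"
  shows "half_coth w = 1 / 2 + exp (- w) / (1 - exp (- w))"
proof -
  define X where "X = exp (w / 2)"
  define q where "q = exp (- w)"
  have "X \<noteq> 0" "1 - q \<noteq> 0"
    using assms by (simp_all add: X_def q_def)
  have "exp (- (w / 2)) = X * q"
    unfolding X_def q_def exp_add[symmetric] by (rule arg_cong[where f = exp]) simp
  hence cosh_sinh: "cosh (w / 2) = X * (1 + q) / 2" "sinh (w / 2) = X * (1 - q) / 2"
    by (simp_all add: cosh_field_def sinh_field_def X_def[symmetric] algebra_simps)
  have "half_coth w = (1 + q) / (2 * (1 - q))"
    unfolding half_coth_def cosh_sinh using \<open>X \<noteq> 0\<close> by simp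
  also have "\<dots> = 1 / 2 + q / (1 - q)"
    using \<open>1 - q \<noteq> 0\<close> by (simp add: field_simps)
  finally show ?thesis
    by (simp add: q_def)
qed

lemma half_coth_tendsto_half:
  assumes "filterlim (\<lambda>x. Re (f x)) at_top G"
  shows "((\<lambda>x. half_coth (f x)) \<longlongrightarrow> 1 / 2) G"
proof -
  have "((\<lambda>x. exp (- Re (f x))) \<longlongrightarrow> 0) G"
    using assms by (intro filterlim_compose[OF exp_at_bot]) (simp add: filterlim_uminus_at_bot)
  hence exp_lim: "((\<lambda>x. exp (- f x)) \<longlongrightarrow> 0) G"
    by (intro tendsto_norm_zero_cancel[of "\<lambda>x. exp (- f x)"]) simp
  hence "((\<lambda>x. 1 / 2 + exp (- f x) / (1 - exp (- f x))) \<longlongrightarrow> 1 / 2 + 0 / (1 - 0)) G"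
    by (intro tendsto_intros) simp_all
  moreover have "\<forall>\<^sub>F x in G. half_coth (f x) = 1 / 2 + exp (- f x) / (1 - exp (- f x))"
    using filterlim_at_top_dense[THEN iffD1, OF assms, rule_format, of 0]
  proof eventually_elim
    case (elim x)
    hence "norm (exp (- f x)) < 1"
      by simp
    hence "exp (- f x) \<noteq> 1"
      by (metis less_irrefl norm_one)
    thus ?case
      by (rule half_coth_conv_exp)
  qed
  ultimately show ?thesis
    by (simp add: tendsto_cong)
qed

lemma inverse_squares_Suc_sums: "(\<lambda>m. 1 / (real (Suc m))\<^sup>2) sums (pi\<^sup>2 / 6)"
  using inverse_squares_sums by (simp add: add.commute)

lemma suminf_reduced_partial_sum:
  assumes "Re s > 0"
  shows "(\<Sum>m. reduced_partial_sum (of_nat (Suc m) * s) (Suc N))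
       = of_real pi ^ 2 / (6 * s\<^sup>2)
         + (of_real (\<Sum>k<N. 1 / (4 * pi\<^sup>2) * (1 / (real (Suc k))\<^sup>2))
            - 4 * of_real pi ^ 2 / s\<^sup>2 * (\<Sum>k<N. half_csch_sq (of_nat (Suc k) * (4 * of_real pi ^ 2 / s))))
         - (2 * of_real pi * \<i> / s * half_coth (of_real (4 * pi\<^sup>2 * (real N + 1/2)) / s)
             - \<i> / of_real (2 * pi * (real N + 1/2))) / (2 * of_real pi * \<i>)"
proof -
  define I where "I = (\<lambda>m y. 1 / (imag_shift (of_nat (Suc m) * s) y)\<^sup>2)"
  have Re_pos: "Re (of_nat (Suc m) * s) > 0" for m
    using assms by simp
  have "(\<lambda>m. complex_of_real (1 / (real (Suc m))\<^sup>2)) sums of_real (pi\<^sup>2 / 6)"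
    using inverse_squares_Suc_sums by (subst sums_of_real_iff)
  from sums_mult[OF this, of "1 / s\<^sup>2"]
  have zero_column: "(\<lambda>m. paired (I m) 0) sums (of_real pi ^ 2 / (6 * s\<^sup>2))"
    by (simp add: I_def paired_def imag_shift_def power_mult_distrib mult_ac)
  have "(\<lambda>m. paired (I m) (Suc k)) sums (of_real (1 / (4 * pi\<^sup>2) * (1 / (real (Suc k))\<^sup>2))
      - 4 * of_real pi ^ 2 / s\<^sup>2 * half_csch_sq (of_nat (Suc k) * (4 * of_real pi ^ 2 / s)))" for k
    using column_sums_inverse_square[OF assms, of "real (Suc k)"]
    by (simp add: I_def paired_def mult_ac del: of_nat_Suc)
  hence "(\<lambda>m. \<Sum>k<Suc N. paired (I m) k) sums (of_real pi ^ 2 / (6 * s\<^sup>2)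
      + (\<Sum>k<N. of_real (1 / (4 * pi\<^sup>2) * (1 / (real (Suc k))\<^sup>2))
          - 4 * of_real pi ^ 2 / s\<^sup>2 * half_csch_sq (of_nat (Suc k) * (4 * of_real pi ^ 2 / s))))"
    unfolding sum.lessThan_Suc_shift by (intro sums_add sums_sum zero_column)
  from sums_diff[OF this sums_divide[OF column_sums_inverse[OF assms, of "real N + 1/2"],
      of "2 * of_real pi * \<i>"]]
  show ?thesis
    unfolding reduced_partial_sum_Suc[OF Re_pos]
    by (simp add: I_def sums_iff sum_subtractf sum_distrib_left del: of_nat_Suc sum.lessThan_Suc)
qed

lemma suminf_reduced_partial_sum_tendsto:
  assumes "Re s > 0"
  shows "(\<lambda>N. \<Sum>m. reduced_partial_sum (of_nat (Suc m) * s) (Suc N)) \<longlonglongrightarrow> sigma_series s"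
proof -
  obtain K where K: "\<And>x N. x \<ge> 1 \<Longrightarrow> norm (reduced_partial_sum (of_real x * s) N) \<le> K / x\<^sup>2"
    using norm_reduced_partial_sum_le[OF assms] by blast
  have "(\<lambda>N. \<Sum>m. reduced_partial_sum (of_nat (Suc m) * s) (Suc N))
      \<longlonglongrightarrow> (\<Sum>m. half_csch_sq (of_nat (Suc m) * s))"
  proof (rule tannerys_theorem[THEN conjunct2, THEN conjunct2])
    show "(\<lambda>N. reduced_partial_sum (of_nat (Suc m) * s) (Suc N)) \<longlonglongrightarrow> half_csch_sq (of_nat (Suc m) * s)"
      for m
      using assms by (intro reduced_partial_sum_tendsto) simp
    have "norm (reduced_partial_sum (of_nat (Suc m) * s) N) \<le> K * (1 / (real (Suc m))\<^sup>2)" for m N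
      using K[of "real (Suc m)" N] by (simp del: of_nat_Suc)
    thus "\<forall>\<^sub>F (m, N) in at_top \<times>\<^sub>F sequentially.
        norm (reduced_partial_sum (of_nat (Suc m) * s) (Suc N)) \<le> K * (1 / (real (Suc m))\<^sup>2)"
      by (simp add: case_prod_unfold)
    show "summable (\<lambda>m. K * (1 / (real (Suc m))\<^sup>2))"
      using inverse_squares_Suc_sums by (intro summable_mult sums_summable)
  qed simp
  thus ?thesis
    using half_csch_sq_sums_sigma_series[OF assms] by (simp add: sums_iff)
qed

lemma Re_of_real_divide: "Re (of_real a / s) = a * Re s / (norm s)\<^sup>2"
  by (simp add: Re_divide cmod_power2)

lemma suminf_reduced_partial_sum_tendsto_dual:
  assumes "Re s > 0"
  shows "(\<lambda>N. \<Sum>m. reduced_partial_sum (of_nat (Suc m) * s) (Suc N)) \<longlonglongrightarrow>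
           of_real pi ^ 2 / (6 * s\<^sup>2) - 1 / (2 * s) + 1 / 24
           - 4 * of_real pi ^ 2 / s\<^sup>2 * sigma_series (4 * of_real pi ^ 2 / s)"
proof -
  have "s \<noteq> 0"
    using assms by auto
  have "(\<lambda>k. 1 / (4 * pi\<^sup>2) * (1 / (real (Suc k))\<^sup>2)) sums (1 / (4 * pi\<^sup>2) * (pi\<^sup>2 / 6))"
    by (intro sums_mult inverse_squares_Suc_sums)
  hence zeta_limit: "(\<lambda>N. complex_of_real (\<Sum>k<N. 1 / (4 * pi\<^sup>2) * (1 / (real (Suc k))\<^sup>2)))
      \<longlonglongrightarrow> of_real (1 / 24)"
    unfolding sums_def by (intro tendsto_of_real) simp
  have "Re (4 * of_real pi ^ 2 / s) > 0"
    using Re_of_real_divide[of "4 * pi\<^sup>2" s] assms \<open>s \<noteq> 0\<close> by simp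
  hence dual_limit: "(\<lambda>N. \<Sum>k<N. half_csch_sq (of_nat (Suc k) * (4 * of_real pi ^ 2 / s)))
      \<longlonglongrightarrow> sigma_series (4 * of_real pi ^ 2 / s)"
    using half_csch_sq_sums_sigma_series unfolding sums_def by blast
  have coth_limit: "(\<lambda>N. half_coth (of_real (4 * pi\<^sup>2 * (real N + 1/2)) / s)) \<longlonglongrightarrow> 1 / 2"
  proof (rule half_coth_tendsto_half)
    have "4 * pi\<^sup>2 * Re s / (norm s)\<^sup>2 > 0"
      using assms \<open>s \<noteq> 0\<close> by simp
    from filterlim_tendsto_pos_mult_at_top[OF tendsto_const this filterlim_half_integers_at_top]
    show "filterlim (\<lambda>N. Re (of_real (4 * pi\<^sup>2 * (real N + 1/2)) / s)) at_top sequentially"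
      unfolding Re_of_real_divide by (simp add: mult_ac)
  qed
  have boundary_limit: "(\<lambda>N. \<i> / of_real (2 * pi * (real N + 1/2))) \<longlonglongrightarrow> 0"
  proof -
    have "(\<lambda>N. - (1 / imag_shift 0 (real N + 1/2))) \<longlonglongrightarrow> - 0"
      using filterlim_half_integers_at_top by (intro tendsto_minus inverse_imag_shift_tendsto_0) simp
    moreover have "- (1 / imag_shift 0 y) = \<i> / of_real (2 * pi * y)" for y
      by (cases "y = 0") (simp_all add: imag_shift_def field_simps)
    ultimately show ?thesis
      by (simp only: minus_zero)
  qed
  have "(\<lambda>N. \<Sum>m. reduced_partial_sum (of_nat (Suc m) * s) (Suc N)) \<longlonglongrightarrow> of_real pi ^ 2 / (6 * s\<^sup>2)
      + (of_real (1 / 24) - 4 * of_real pi ^ 2 / s\<^sup>2 * sigma_series (4 * of_real pi ^ 2 / s))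
      - (2 * of_real pi * \<i> / s * (1 / 2) - 0) / (2 * of_real pi * \<i>)"
    unfolding suminf_reduced_partial_sum[OF assms]
    by (intro tendsto_intros zeta_limit dual_limit coth_limit boundary_limit) simp_all
  thus ?thesis
    by (simp add: algebra_simps)
qed

theorem sigma_series_transformation:
  assumes "Re s > 0"
  shows "sigma_series s = of_real pi ^ 2 / (6 * s\<^sup>2) - 1 / (2 * s) + 1 / 24
           - 4 * of_real pi ^ 2 / s\<^sup>2 * sigma_series (4 * of_real pi ^ 2 / s)"
  using suminf_reduced_partial_sum_tendsto[OF assms] suminf_reduced_partial_sum_tendsto_dual[OF assms]
  by (rule LIMSEQ_unique)

section \<open>Hyperbolic functions in a vertical strip\<close>

lemma power_div_fact_le_sinh:
  fixes x :: real
  assumes "x \<ge> 0" "odd k"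
  shows "x ^ k / fact k \<le> sinh x"
proof -
  have "(\<Sum>n\<in>{k}. if even n then 0 else x ^ n /\<^sub>R fact n) \<le> sinh x"
    unfolding sums_unique[OF sinh_converges]
    by (rule sum_le_suminf[OF sums_summable[OF sinh_converges]]) (use assms in auto)
  thus ?thesis
    using assms by (simp add: field_simps)
qed

lemma norm_sinh_squared: "(norm (sinh z))\<^sup>2 = (sinh (Re z))\<^sup>2 + (sin (Im z))\<^sup>2"
  and norm_cosh_squared: "(norm (cosh z))\<^sup>2 = (sinh (Re z))\<^sup>2 + (cos (Im z))\<^sup>2" for z :: complex
proof -
  have sinh_Re_sq: "(sinh (Re z))\<^sup>2 = (exp (Re z) - inverse (exp (Re z)))\<^sup>2 / 4"
    by (simp add: sinh_field_def exp_minus power_divide)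
  show "(norm (cosh z))\<^sup>2 = (sinh (Re z))\<^sup>2 + (cos (Im z))\<^sup>2"
    unfolding cosh_conv_cos norm_cos_squared sinh_Re_sq by simp
  have "norm (sinh z) = norm (cos (of_real pi / 2 - \<i> * z))"
    by (simp add: sinh_conv_sin norm_mult sin_cos_eq)
  thus "(norm (sinh z))\<^sup>2 = (sinh (Re z))\<^sup>2 + (sin (Im z))\<^sup>2"
    unfolding sinh_Re_sq by (simp add: norm_cos_squared cos_add exp_minus power2_commute)
qed

lemma sin_ge_linear:
  fixes x :: real
  assumes "0 \<le> x" "x \<le> pi / 2"
  shows "2 * x / pi \<le> sin x"
proof -
  have "convex_on {0..pi / 2} (\<lambda>x. - sin x)"
  proof (rule f''_ge0_imp_convex)
    show "((\<lambda>x. - sin x) has_real_derivative - cos x) (at x)"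
      "((\<lambda>x. - cos x) has_real_derivative sin x) (at x)" for x :: real
      by (auto intro!: derivative_eq_intros)
    show "0 \<le> sin x" if "x \<in> {0..pi / 2}" for x
      using that by (intro sin_ge_zero) auto
  qed simp
  from convex_onD_Icc[OF this, of "2 * x / pi"] assms show ?thesis
    by (simp add: field_simps)
qed

lemma norm_le_pi_norm_sinh_half:
  assumes "\<bar>Im s\<bar> \<le> pi"
  shows "norm s \<le> pi * norm (sinh (s / 2))"
proof -
  have "\<bar>Re s / 2\<bar> \<le> \<bar>sinh (Re s / 2)\<bar>"
    using real_le_abs_sinh[of "Re s / 2"] by (simp add: sinh_field_def exp_minus)
  hence "pi\<^sup>2 * (Re s / 2)\<^sup>2 \<le> pi\<^sup>2 * (sinh (Re s / 2))\<^sup>2"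
    by (intro mult_left_mono abs_le_square_iff[THEN iffD1]) simp_all
  moreover have "4 * (Re s / 2)\<^sup>2 \<le> pi\<^sup>2 * (Re s / 2)\<^sup>2"
    using power_mono[of 2 pi 2] pi_gt3 by (intro mult_right_mono) auto
  moreover have "2 * (\<bar>Im s\<bar> / 2) / pi \<le> sin (\<bar>Im s\<bar> / 2)"
    using assms by (intro sin_ge_linear) auto
  hence "\<bar>Im s\<bar> \<le> pi * sin (\<bar>Im s\<bar> / 2)"
    by (simp add: field_simps)
  hence "\<bar>Im s\<bar>\<^sup>2 \<le> (pi * sin (\<bar>Im s\<bar> / 2))\<^sup>2"
    by (intro power_mono) auto
  hence "(Im s)\<^sup>2 \<le> pi\<^sup>2 * (sin (Im s / 2))\<^sup>2"
    by (cases "Im s \<ge> 0") (simp_all add: power_mult_distrib)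
  moreover have "(norm s)\<^sup>2 = 4 * (Re s / 2)\<^sup>2 + (Im s)\<^sup>2"
    by (simp add: cmod_power2 power_divide)
  moreover have "(pi * norm (sinh (s / 2)))\<^sup>2 = pi\<^sup>2 * (sinh (Re s / 2))\<^sup>2 + pi\<^sup>2 * (sin (Im s / 2))\<^sup>2"
    using norm_sinh_squared[of "s / 2"] by (simp add: power_mult_distrib distrib_left)
  ultimately have "(norm s)\<^sup>2 \<le> (pi * norm (sinh (s / 2)))\<^sup>2"
    by linarith
  thus ?thesis
    by (rule power2_le_imp_le) simp
qed

lemma norm_le_in_strip:
  assumes "\<bar>Re s\<bar> \<le> 1/50" "\<bar>Im s\<bar> \<le> pi"
  shows "norm s \<le> 16/5"
  using cmod_le[of s] assms pi_approx by simp

lemma norm_half_csch_sq_le: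
  assumes "Re w > 0" "odd k"
  shows "norm (half_csch_sq w) \<le> (fact k)\<^sup>2 / 4 * (2 / Re w) ^ (2 * k)"
proof -
  have "(Re w / 2) ^ k / fact k \<le> sinh (Re w / 2)"
    using assms by (intro power_div_fact_le_sinh) auto
  hence "((Re w / 2) ^ k / fact k)\<^sup>2 \<le> (sinh (Re w / 2))\<^sup>2"
    using assms(1) by (intro power_mono) auto
  also have "\<dots> \<le> (norm (sinh (w / 2)))\<^sup>2"
    by (simp add: norm_sinh_squared)
  finally have "norm (half_csch_sq w) \<le> 1 / (4 * ((Re w / 2) ^ k / fact k)\<^sup>2)"
    unfolding half_csch_sq_def norm_divide norm_power norm_mult
    using assms(1) by (simp add: power_mult_distrib frac_le)
  also have "\<dots> = (fact k)\<^sup>2 / 4 * (2 / Re w) ^ (2 * k)"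
    by (simp add: power_divide power_mult_distrib power_even_eq)
  finally show ?thesis .
qed

lemma norm_sigma_series_le:
  assumes "Re w > 0" "odd k"
  shows "norm (sigma_series w) \<le> pi\<^sup>2 / 24 * (fact k)\<^sup>2 * (2 / Re w) ^ (2 * k)"
proof -
  define B where "B = (fact k)\<^sup>2 / 4 * (2 / Re w) ^ (2 * k)"
  have "B \<ge> 0"
    using assms(1) by (simp add: B_def)
  have term_le: "norm (half_csch_sq (of_nat (Suc m) * w)) \<le> B * (1 / (real (Suc m))\<^sup>2)" for m
  proof -
    have "norm (half_csch_sq (of_nat (Suc m) * w)) \<le> (fact k)\<^sup>2 / 4 * (2 / Re (of_nat (Suc m) * w)) ^ (2 * k)"
      using assms by (intro norm_half_csch_sq_le) simp_all
    also have "\<dots> = B * (1 / real (Suc m) ^ (2 * k))"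
      by (simp add: B_def power_divide power_mult_distrib del: of_nat_Suc)
    also have "\<dots> \<le> B * (1 / (real (Suc m))\<^sup>2)"
      using \<open>B \<ge> 0\<close> odd_pos[OF assms(2)]
      by (intro mult_left_mono divide_left_mono power_increasing) auto
    finally show ?thesis .
  qed
  have bound_sums: "(\<lambda>m. B * (1 / (real (Suc m))\<^sup>2)) sums (B * (pi\<^sup>2 / 6))"
    by (intro sums_mult inverse_squares_Suc_sums)
  have "norm (\<Sum>m. half_csch_sq (of_nat (Suc m) * w)) \<le> B * (pi\<^sup>2 / 6)"
    using norm_suminf_le[OF term_le sums_summable[OF bound_sums]]
    unfolding sums_unique[OF bound_sums, symmetric] .
  thus ?thesis
    using half_csch_sq_sums_sigma_series[OF assms(1)] by (simp add: sums_iff B_def mult_ac)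
qed

lemma norm_sigma_series_dual_le:
  assumes "Re s > 0"
  shows "norm (4 * of_real pi ^ 2 / s\<^sup>2 * sigma_series (4 * of_real pi ^ 2 / s))
           \<le> 24 * (norm s / pi) ^ 18 / Re s ^ 10"
proof -
  have "s \<noteq> 0"
    using assms by auto
  define v where "v = (norm s / pi)\<^sup>2"
  have "v > 0"
    using \<open>s \<noteq> 0\<close> by (simp add: v_def)
  have norm_s: "(norm s)\<^sup>2 = pi\<^sup>2 * v"
    by (simp add: v_def power_divide)
  have Re_dual: "Re (4 * of_real pi ^ 2 / s) = 4 * Re s / v"
    using Re_of_real_divide[of "4 * pi\<^sup>2" s] by (simp add: norm_s)
  have "norm (sigma_series (4 * of_real pi ^ 2 / s))
      \<le> pi\<^sup>2 / 24 * (fact 5)\<^sup>2 * (2 / (4 * Re s / v)) ^ (2 * 5)"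
    using norm_sigma_series_le[of "4 * of_real pi ^ 2 / s" 5] assms \<open>v > 0\<close> by (simp add: Re_dual)
  hence "norm (4 * of_real pi ^ 2 / s\<^sup>2 * sigma_series (4 * of_real pi ^ 2 / s))
      \<le> 4 / v * (pi\<^sup>2 / 24 * (fact 5)\<^sup>2 * (2 / (4 * Re s / v)) ^ (2 * 5))"
    using \<open>v > 0\<close> unfolding norm_mult norm_divide norm_power norm_s
    by (intro mult_mono) auto
  also have "\<dots> = 75 / 32 * pi\<^sup>2 * (v ^ 9 / Re s ^ 10)"
    using \<open>v > 0\<close> assms
    by (simp add: fact_numeral power_divide power_mult_distrib eval_nat_numeral field_simps)
  also have "\<dots> \<le> 24 * (v ^ 9 / Re s ^ 10)"
  proof (intro mult_right_mono)
    have "pi\<^sup>2 \<le> 3.1416\<^sup>2"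
      using pi_approx by (intro power_mono) auto
    thus "75 / 32 * pi\<^sup>2 \<le> 24"
      by (simp add: power2_eq_square)
  qed (use \<open>v > 0\<close> assms in auto)
  also have "v ^ 9 = (norm s / pi) ^ 18"
    by (simp add: v_def flip: power_mult)
  finally show ?thesis
    by simp
qed

section \<open>Taylor approximations\<close>

lemma
  fixes z :: complex
  assumes "\<bar>Re z\<bar> \<le> 1/2"
  shows norm_cosh_taylor_le:
      "norm (cosh z - (\<Sum>k\<le>n. if even k then z ^ k / fact k else 0)) \<le> 2 * norm z ^ Suc n / fact n"
    and norm_sinh_taylor_le:
      "norm (sinh z - (\<Sum>k\<le>n. if even k then 0 else z ^ k / fact k)) \<le> 2 * norm z ^ Suc n / fact n"
proof -
  define R where "R = (\<lambda>w. exp w - (\<Sum>k\<le>n. w ^ k / fact k :: complex))"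
  define B where "B = 2 * norm z ^ Suc n / fact n"
  have "exp \<bar>Re z\<bar> \<le> 2"
    using exp_half_le2 assms by (meson exp_le_cancel_iff order_trans)
  hence "exp \<bar>Re z\<bar> * norm z ^ Suc n / fact n \<le> B"
    unfolding B_def by (intro divide_right_mono mult_right_mono) auto
  hence R_le: "norm (R z) \<le> B" "norm (R (- z)) \<le> B"
    using Taylor_exp[of z n] Taylor_exp[of "- z" n] by (simp_all add: R_def)
  have "cosh z - (\<Sum>k\<le>n. if even k then z ^ k / fact k else 0) = (R z + R (- z)) / 2"
  proof -
    have "(if even k then z ^ k / fact k else 0) = (z ^ k / fact k + (- z) ^ k / fact k) / 2" for k
      by simp
    thus ?thesis
      unfolding R_def cosh_field_def
      by (simp only: sum.distrib flip: sum_divide_distrib) (simp add: field_simps)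
  qed
  also have "norm \<dots> \<le> B"
    using norm_triangle_ineq[of "R z" "R (- z)"] R_le by (simp add: norm_divide)
  finally show "norm (cosh z - (\<Sum>k\<le>n. if even k then z ^ k / fact k else 0)) \<le> 2 * norm z ^ Suc n / fact n"
    unfolding B_def .
  have "sinh z - (\<Sum>k\<le>n. if even k then 0 else z ^ k / fact k) = (R z - R (- z)) / 2"
  proof -
    have "(if even k then 0 else z ^ k / fact k) = (z ^ k / fact k - (- z) ^ k / fact k) / 2" for k
      by simp
    thus ?thesis
      unfolding R_def sinh_field_def
      by (simp only: sum_subtractf flip: sum_divide_distrib) (simp add: field_simps)
  qed
  also have "norm \<dots> \<le> B"
    using norm_triangle_ineq4[of "R z" "R (- z)"] R_le by (simp add: norm_divide)
  finally show "norm (sinh z - (\<Sum>k\<le>n. if even k then 0 else z ^ k / fact k)) \<le> 2 * norm z ^ Suc n / fact n"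
    unfolding B_def .
qed

lemmas norm_diff_mono = order_trans[OF norm_triangle_ineq4 add_mono]

lemma norm_power_le:
  fixes z :: "'a::real_normed_div_algebra"
  assumes "norm z \<le> b"
  shows "norm (z ^ k) \<le> b ^ k"
  using assms by (simp add: norm_power power_mono)

text \<open>\<open>q\<close> is the beginning of the expansion of \<open>t coth t\<close>.\<close>

lemma norm_cosh_minus_sinh_taylor_le:
  fixes t :: complex
  assumes "norm t \<le> 8/5" "\<bar>Re t\<bar> \<le> 1/2"
  defines "q \<equiv> 1 + t\<^sup>2 / 3 - t ^ 4 / 45 + 2 * t ^ 6 / 945"
  shows "norm (t * cosh t - q * sinh t) \<le> norm t ^ 9 / 1200"
proof -
  define c where "c = 1 + t\<^sup>2 / 2 + t ^ 4 / 24 + t ^ 6 / 720"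
  define s where "s = t + t ^ 3 / 6 + t ^ 5 / 120 + t ^ 7 / 5040"
  define p where "p = - 53 / 226800 - t\<^sup>2 / 75600 - t ^ 4 / 2381400"
  have t_power: "norm (t ^ k) \<le> (8 / 5) ^ k" for k
    using assms(1) by (rule norm_power_le)
  have cosh_remainder: "norm (cosh t - c) \<le> norm t ^ 8 / 2520"
    using norm_cosh_taylor_le[OF assms(2), of 7]
    by (simp add: c_def atMost_nat_numeral fact_numeral add_ac)
  have sinh_remainder: "norm (sinh t - s) \<le> norm t ^ 9 / 20160"
    using norm_sinh_taylor_le[OF assms(2), of 8]
    by (simp add: s_def atMost_nat_numeral fact_numeral add_ac)
  have "norm q \<le> 1 + (8 / 5)\<^sup>2 / 3 + (8 / 5) ^ 4 / 45 + 2 * (8 / 5) ^ 6 / 945"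
    unfolding q_def using t_power
    by (intro norm_triangle_mono norm_diff_mono) (simp_all add: norm_divide norm_mult divide_right_mono)
  also have "\<dots> \<le> 5 / 2"
    by (simp add: power_divide)
  finally have norm_q: "norm q \<le> 5 / 2" .
  have "norm p \<le> 53 / 226800 + (8 / 5)\<^sup>2 / 75600 + (8 / 5) ^ 4 / 2381400"
    unfolding p_def using t_power
    by (intro norm_diff_mono) (simp_all add: norm_divide divide_right_mono)
  also have "\<dots> \<le> 1 / 3500"
    by (simp add: power_divide)
  finally have norm_p: "norm p \<le> 1 / 3500" .
  have "t * c - q * s = t ^ 9 * p"
    unfolding q_def c_def s_def p_def by (simp add: field_simps eval_nat_numeral)
  hence "t * cosh t - q * sinh t = t * (cosh t - c) - q * (sinh t - s) + t ^ 9 * p"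
    by (simp add: algebra_simps)
  also have "norm \<dots> \<le> norm t * (norm t ^ 8 / 2520) + 5 / 2 * (norm t ^ 9 / 20160) + norm t ^ 9 * (1 / 3500)"
    by (intro norm_triangle_mono norm_diff_mono)
      (simp_all only: norm_mult norm_power mult_mono mult_left_mono norm_q norm_p
        cosh_remainder sinh_remainder
        norm_ge_zero zero_le_power divide_nonneg_nonneg zero_le_numeral)
  also have "\<dots> = norm t ^ 9 * (1 / 2520 + 5 / 40320 + 1 / 3500)"
    by (simp add: eval_nat_numeral field_simps)
  also have "\<dots> \<le> norm t ^ 9 / 1200"
    by simp
  finally show ?thesis .
qed

definition half_coth_poly :: "complex \<Rightarrow> complex" where
  "half_coth_poly s = 1 + s\<^sup>2 / 12 - s ^ 4 / 720 + s ^ 6 / 30240"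

lemma half_coth_taylor:
  assumes "s \<noteq> 0" "\<bar>Re s\<bar> \<le> 1/50" "\<bar>Im s\<bar> \<le> pi"
  shows "norm (s * half_coth s - half_coth_poly s) \<le> norm s ^ 8 / 180000"
proof -
  define t where "t = s / 2"
  define q where "q = 1 + t\<^sup>2 / 3 - t ^ 4 / 45 + 2 * t ^ 6 / 945"
  have s_eq: "s = 2 * t"
    by (simp add: t_def)
  have "2 * norm t \<le> pi * norm (sinh t)"
    using norm_le_pi_norm_sinh_half[OF assms(3)] by (simp add: t_def norm_divide)
  also have "\<dots> \<le> 10 / 3 * norm (sinh t)"
    using pi_approx by (intro mult_right_mono) auto
  finally have sinh_ge: "3 / 5 * norm t \<le> norm (sinh t)"
    by simp
  have "t \<noteq> 0"
    using assms(1) by (simp add: t_def)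
  hence "sinh t \<noteq> 0"
    using sinh_ge by auto
  have "norm (t * cosh t - q * sinh t) \<le> norm t ^ 9 / 1200"
    unfolding q_def using norm_le_in_strip[OF assms(2,3)] assms(2)
    by (intro norm_cosh_minus_sinh_taylor_le) (simp_all add: t_def norm_divide)
  moreover have "s * half_coth s - q = (t * cosh t - q * sinh t) / sinh t"
    using \<open>sinh t \<noteq> 0\<close> by (simp add: half_coth_def s_eq field_simps)
  ultimately have "norm (s * half_coth s - q) \<le> (norm t ^ 9 / 1200) / (3 / 5 * norm t)"
    using sinh_ge \<open>t \<noteq> 0\<close> by (simp only: norm_divide) (intro frac_le; simp)
  also have "\<dots> = norm t ^ 8 / 720"
    using \<open>t \<noteq> 0\<close> by (simp add: eval_nat_numeral)
  also have "\<dots> \<le> norm s ^ 8 / 180000"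
    by (simp add: s_eq norm_mult power_mult_distrib)
  also have "q = half_coth_poly s"
    by (simp add: q_def half_coth_poly_def s_eq power_mult_distrib)
  finally show ?thesis .
qed

lemma half_csch_sq_conv_half_coth:
  assumes "sinh (s / 2) \<noteq> 0"
  shows "half_csch_sq s = (half_coth s)\<^sup>2 - 1 / 4"
  using assms cosh_square_eq[of "s / 2"]
  by (simp add: half_csch_sq_def half_coth_def power_divide power_mult_distrib field_simps)

lemma half_csch_sq_taylor_remainder:
  fixes s :: complex
  defines "\<rho> \<equiv> s * half_coth s - half_coth_poly s"
    and "p \<equiv> 1 / 518400 + 1 / 181440 - s\<^sup>2 / 10886400 + s ^ 4 / 914457600"
  assumes "s \<noteq> 0" "sinh (s / 2) \<noteq> 0"
  shows "s\<^sup>2 * (1 / s\<^sup>2 - half_csch_sq s - (1 / 12 - s\<^sup>2 / 240 + s ^ 4 / 6048))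
       = - (s ^ 8 * p) - \<rho> * (2 * half_coth_poly s + \<rho>)"
proof -
  define q where "q = half_coth_poly s"
  define T where "T = 1 / 12 - s\<^sup>2 / 240 + s ^ 4 / 6048"
  have "s\<^sup>2 * half_csch_sq s = (s * half_coth s)\<^sup>2 - s\<^sup>2 / 4"
    using assms(4) by (simp add: half_csch_sq_conv_half_coth algebra_simps power_mult_distrib)
  also have "s * half_coth s = q + \<rho>"
    by (simp add: \<rho>_def q_def)
  finally have "s\<^sup>2 * (1 / s\<^sup>2 - half_csch_sq s - T) = 1 - ((q + \<rho>)\<^sup>2 - s\<^sup>2 / 4) - s\<^sup>2 * T"
    using assms(3) by (simp add: right_diff_distrib)
  also have "\<dots> = (1 + s\<^sup>2 / 4 - s\<^sup>2 * T - q\<^sup>2) - \<rho> * (2 * q + \<rho>)"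
    by (simp add: power2_eq_square algebra_simps)
  also have "1 + s\<^sup>2 / 4 - s\<^sup>2 * T - q\<^sup>2 = - (s ^ 8 * p)"
    unfolding q_def half_coth_poly_def p_def T_def by (simp add: field_simps eval_nat_numeral)
  finally show ?thesis
    by (simp add: T_def q_def)
qed

lemma half_csch_sq_taylor:
  assumes "s \<noteq> 0" "\<bar>Re s\<bar> \<le> 1/50" "\<bar>Im s\<bar> \<le> pi"
  shows "norm (1 / s\<^sup>2 - half_csch_sq s - (1 / 12 - s\<^sup>2 / 240 + s ^ 4 / 6048)) \<le> norm s ^ 6 / 25000"
proof -
  define q where "q = half_coth_poly s"
  define \<rho> where "\<rho> = s * half_coth s - q"
  define p where "p = 1 / 518400 + 1 / 181440 - s\<^sup>2 / 10886400 + s ^ 4 / 914457600"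
  define r where "r = 1 / s\<^sup>2 - half_csch_sq s - (1 / 12 - s\<^sup>2 / 240 + s ^ 4 / 6048)"
  have s_power: "norm (s ^ k) \<le> (16 / 5) ^ k" for k
    using norm_le_in_strip[OF assms(2,3)] by (rule norm_power_le)
  have norm_\<rho>: "norm \<rho> \<le> norm s ^ 8 / 180000"
    unfolding \<rho>_def q_def by (rule half_coth_taylor[OF assms])
  have "norm p \<le> (1 / 518400 + 1 / 181440) + (16 / 5)\<^sup>2 / 10886400 + (16 / 5) ^ 4 / 914457600"
    unfolding p_def using s_power
    by (intro norm_triangle_mono norm_diff_mono) (simp_all add: norm_divide divide_right_mono)
  also have "\<dots> \<le> 1 / 100000"
    by (simp add: power_divide)
  finally have norm_p: "norm p \<le> 1 / 100000" .
  have "norm q \<le> 1 + (16 / 5)\<^sup>2 / 12 + (16 / 5) ^ 4 / 720 + (16 / 5) ^ 6 / 30240"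
    unfolding q_def half_coth_poly_def using s_power
    by (intro norm_triangle_mono norm_diff_mono) (simp_all add: norm_divide divide_right_mono)
  hence "norm (2 * q + \<rho>) \<le> 2 * (5 / 2) + (16 / 5) ^ 8 / 180000"
    using norm_\<rho> s_power[of 8]
    by (intro norm_triangle_mono) (simp_all add: norm_mult norm_power power_divide)
  hence norm_factor: "norm (2 * q + \<rho>) \<le> 51 / 10"
    by (simp add: power_divide)
  have "sinh (s / 2) \<noteq> 0"
    using norm_le_pi_norm_sinh_half[OF assms(3)] assms(1) by auto
  hence "s\<^sup>2 * r = - (s ^ 8 * p) - \<rho> * (2 * q + \<rho>)"
    unfolding r_def \<rho>_def q_def p_def by (rule half_csch_sq_taylor_remainder[OF assms(1)])
  also have "norm \<dots> \<le> norm s ^ 8 * (1 / 100000) + norm s ^ 8 / 180000 * (51 / 10)"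
    by (intro norm_diff_mono)
      (simp_all only: norm_minus_cancel norm_mult norm_power mult_mono mult_left_mono
        norm_p norm_\<rho> norm_factor
        norm_ge_zero zero_le_power divide_nonneg_nonneg zero_le_numeral)
  also have "\<dots> \<le> (norm s)\<^sup>2 * (norm s ^ 6 / 25000)"
    by (simp flip: power_add)
  finally have "(norm s)\<^sup>2 * norm r \<le> (norm s)\<^sup>2 * (norm s ^ 6 / 25000)"
    by (simp add: norm_mult norm_power)
  thus ?thesis
    unfolding r_def[symmetric] by (rule mult_left_le_imp_le) (use assms(1) in auto)
qed

lemma half_coth_taylor_cubic:
  assumes "s \<noteq> 0" "\<bar>Re s\<bar> \<le> 1/50" "\<bar>Im s\<bar> \<le> pi"
  shows "norm ((half_coth s - 1 / s) / 2 - (s / 24 - s ^ 3 / 1440)) \<le> norm s ^ 5 / 20000"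
proof -
  define \<rho> where "\<rho> = s * half_coth s - half_coth_poly s"
  define r where "r = (half_coth s - 1 / s) / 2 - (s / 24 - s ^ 3 / 1440)"
  have "norm \<rho> \<le> norm s ^ 8 / 180000"
    unfolding \<rho>_def by (rule half_coth_taylor[OF assms])
  also have "\<dots> = norm s ^ 2 * norm s ^ 6 / 180000"
    by (simp flip: power_add)
  also have "\<dots> \<le> (16 / 5)\<^sup>2 * norm s ^ 6 / 180000"
    using norm_le_in_strip[OF assms(2,3)] by (intro divide_right_mono mult_right_mono power_mono) auto
  also have "\<dots> \<le> norm s ^ 6 / 17500"
    by (simp add: power2_eq_square)
  finally have norm_\<rho>: "norm \<rho> \<le> norm s ^ 6 / 17500" .
  have "s * r = \<rho> / 2 + s ^ 6 / 60480"
    using assms(1) unfolding r_def \<rho>_def half_coth_poly_def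
    by (simp add: field_simps eval_nat_numeral)
  hence "norm s * norm r = norm (\<rho> / 2 + s ^ 6 / 60480)"
    by (simp flip: norm_mult)
  also have "\<dots> \<le> norm s ^ 6 / 17500 / 2 + norm s ^ 6 / 60480"
    using norm_\<rho> by (intro norm_triangle_mono) (simp_all add: norm_divide norm_power)
  also have "\<dots> \<le> norm s ^ 6 / 20000"
    using zero_le_power[OF norm_ge_zero[of s], of 6] by linarith
  also have "\<dots> = norm s * (norm s ^ 5 / 20000)"
    by (simp add: eval_nat_numeral)
  finally show ?thesis
    using assms(1) by (simp add: r_def)
qed

text \<open>The coefficients make the Taylor expansions agree through \<open>s\<^sup>4\<close> in the next two lemmas.\<close>

definition cosh_approx :: "complex \<Rightarrow> complex" where
  "cosh_approx s = 191 / 2016 - 47 / 3780 * cosh s + 31 / 30240 * cosh (2 * s)"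

definition sinh_approx :: "complex \<Rightarrow> complex" where
  "sinh_approx s = 41 / 720 * sinh s - 11 / 1440 * sinh (2 * s)"

lemma half_csch_sq_cosh_approximation:
  assumes "s \<noteq> 0" "\<bar>Re s\<bar> \<le> 1/50" "\<bar>Im s\<bar> \<le> pi"
  shows "norm (1 / s\<^sup>2 - half_csch_sq s - cosh_approx s) \<le> norm s ^ 6 / 700"
proof -
  define r where "r = 1 / s\<^sup>2 - half_csch_sq s - (1 / 12 - s\<^sup>2 / 240 + s ^ 4 / 6048)"
  define r1 where "r1 = cosh s - (1 + s\<^sup>2 / 2 + s ^ 4 / 24)"
  define r2 where "r2 = cosh (2 * s) - (1 + (2 * s)\<^sup>2 / 2 + (2 * s) ^ 4 / 24)"
  have Re_small: "\<bar>Re s\<bar> \<le> 1/2" "\<bar>Re (2 * s)\<bar> \<le> 1/2"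
    using assms(2) by (simp_all add: abs_mult)
  have r: "norm r \<le> norm s ^ 6 / 25000"
    unfolding r_def by (rule half_csch_sq_taylor[OF assms])
  have r1: "norm r1 \<le> norm s ^ 6 / 60"
    using norm_cosh_taylor_le[OF Re_small(1), of 5]
    by (simp add: r1_def atMost_nat_numeral fact_numeral add_ac)
  have r2: "norm r2 \<le> 16 / 15 * norm s ^ 6"
    using norm_cosh_taylor_le[OF Re_small(2), of 5]
    by (simp add: r2_def atMost_nat_numeral fact_numeral add_ac norm_mult power_mult_distrib)
  have "1 / s\<^sup>2 - half_csch_sq s - cosh_approx s = r + 47 / 3780 * r1 - 31 / 30240 * r2"
    unfolding cosh_approx_def r_def r1_def r2_def by (simp add: field_simps)
  also have "norm \<dots> \<le> norm s ^ 6 / 25000 + 47 / 3780 * (norm s ^ 6 / 60)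
      + 31 / 30240 * (16 / 15 * norm s ^ 6)"
    using r r1 r2 by (intro norm_triangle_mono norm_diff_mono) (simp_all add: norm_mult)
  also have "\<dots> \<le> norm s ^ 6 / 700"
    using zero_le_power[OF norm_ge_zero[of s], of 6] by linarith
  finally show ?thesis .
qed

lemma half_coth_sinh_approximation:
  assumes "s \<noteq> 0" "\<bar>Re s\<bar> \<le> 1/50" "\<bar>Im s\<bar> \<le> pi"
  shows "norm ((half_coth s - 1 / s) / 2 - sinh_approx s) \<le> norm s ^ 5 / 38"
proof -
  define r where "r = (half_coth s - 1 / s) / 2 - (s / 24 - s ^ 3 / 1440)"
  define r1 where "r1 = sinh s - (s + s ^ 3 / 6)"
  define r2 where "r2 = sinh (2 * s) - (2 * s + (2 * s) ^ 3 / 6)"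
  have Re_small: "\<bar>Re s\<bar> \<le> 1/2" "\<bar>Re (2 * s)\<bar> \<le> 1/2"
    using assms(2) by (simp_all add: abs_mult)
  have r: "norm r \<le> norm s ^ 5 / 20000"
    unfolding r_def by (rule half_coth_taylor_cubic[OF assms])
  have r1: "norm r1 \<le> norm s ^ 5 / 12"
    using norm_sinh_taylor_le[OF Re_small(1), of 4] by (simp add: r1_def atMost_nat_numeral fact_numeral add_ac)
  have r2: "norm r2 \<le> 8 / 3 * norm s ^ 5"
    using norm_sinh_taylor_le[OF Re_small(2), of 4]
    by (simp add: r2_def atMost_nat_numeral fact_numeral add_ac norm_mult power_mult_distrib)
  have "(half_coth s - 1 / s) / 2 - sinh_approx s = r - 41 / 720 * r1 + 11 / 1440 * r2"
    unfolding sinh_approx_def r_def r1_def r2_def by (simp add: field_simps)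
  also have "norm \<dots> \<le> norm s ^ 5 / 20000 + 41 / 720 * (norm s ^ 5 / 12) + 11 / 1440 * (8 / 3 * norm s ^ 5)"
    using r r1 r2 by (intro norm_triangle_mono norm_diff_mono) (simp_all add: norm_mult)
  also have "\<dots> \<le> norm s ^ 5 / 38"
    using zero_le_power[OF norm_ge_zero[of s], of 5] by linarith
  finally show ?thesis .
qed

section \<open>Integrating exponential series against exponential polynomials\<close>

lemma has_integral_exp_period:
  "((\<lambda>t. exp (of_int a * Complex e t)) has_integral (if a = 0 then of_real (2 * pi) else 0)) {- pi..pi}"
proof (cases "a = 0")
  case True
  thus ?thesis
    using has_integral_const_real[of "1 :: complex" "- pi" pi] by (simp add: scaleR_conv_of_real)
next
  case False
  define f where "f = (\<lambda>t. exp (of_int a * Complex e t) / (\<i> * of_int a))"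
  have "((\<lambda>t. exp (of_int a * Complex e t)) has_integral f pi - f (- pi)) {- pi..pi}"
  proof (rule fundamental_theorem_of_calculus)
    show "(f has_vector_derivative exp (of_int a * Complex e t)) (at t within {- pi..pi})" for t
      unfolding f_def Complex_eq using False
      by (intro has_vector_derivative_real_field) (auto intro!: derivative_eq_intros)
  qed simp
  moreover have "of_int a * Complex e pi = of_int a * Complex e (- pi) + of_int (2 * a) * (of_real pi * \<i>)"
    by (simp add: Complex_eq algebra_simps)
  hence "f pi = f (- pi)"
    using exp_integer_2pi[of "of_int a"] by (simp add: f_def exp_add mult_ac)
  ultimately show ?thesis
    using False by simp
qed

lemma has_integral_exp_times_exp_poly:
  fixes c :: "int \<Rightarrow> complex"
  assumes "finite J"
  shows "((\<lambda>t. exp (- (of_int k * Complex e t)) * (\<Sum>j\<in>J. c j * exp (of_int j * Complex e t)))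
           has_integral of_real (2 * pi) * (if k \<in> J then c k else 0)) {- pi..pi}"
proof -
  have "((\<lambda>t. \<Sum>j\<in>J. c j * exp (of_int (j - k) * Complex e t)) has_integral
      (\<Sum>j\<in>J. c j * (if j - k = 0 then of_real (2 * pi) else 0))) {- pi..pi}"
    by (intro has_integral_sum has_integral_mult_right has_integral_exp_period assms)
  moreover have "exp (- (of_int k * s)) * exp (of_int j * s) = exp (of_int (j - k) * s)"
    for j and s :: complex
    unfolding exp_add[symmetric] by (rule arg_cong[where f = exp]) (simp add: algebra_simps)
  hence "exp (- (of_int k * s)) * (\<Sum>j\<in>J. c j * exp (of_int j * s))
      = (\<Sum>j\<in>J. c j * exp (of_int (j - k) * s))" for s
    by (simp only: sum_distrib_left mult.left_commute)
  moreover have "(\<Sum>j\<in>J. c j * (if j - k = 0 then complex_of_real (2 * pi) else 0))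
      = of_real (2 * pi) * (if k \<in> J then c k else 0)"
    using assms by (simp add: if_distrib[of "\<lambda>x. _ * x"] sum.delta' mult.commute cong: if_cong)
  ultimately show ?thesis
    by simp
qed

lemma has_integral_suminf:
  fixes f :: "nat \<Rightarrow> real \<Rightarrow> 'a::banach"
  assumes cont: "\<And>k. continuous_on {a..b} (f k)"
    and bound: "\<And>k t. t \<in> {a..b} \<Longrightarrow> norm (f k t) \<le> M k" "summable M"
    and integral: "\<And>k. (f k has_integral I k) {a..b}" and sums: "I sums S"
  shows "((\<lambda>t. \<Sum>k. f k t) has_integral S) {a..b}"
proof -
  have unif: "uniform_limit {a..b} (\<lambda>N t. \<Sum>k<N. f k t) (\<lambda>t. \<Sum>k. f k t) sequentially"
    using bound by (rule Weierstrass_m_test)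
  have "continuous_on {a..b} (\<lambda>t. \<Sum>k<N. f k t)" for N
    by (intro continuous_on_sum cont)
  then obtain J L where J: "\<And>N. ((\<lambda>t. \<Sum>k<N. f k t) has_integral J N) {a..b}"
    and L: "((\<lambda>t. \<Sum>k. f k t) has_integral L) {a..b}" and lim: "J \<longlonglongrightarrow> L"
    using uniform_limit_integral[OF unif _ sequentially_bot] by metis
  have "((\<lambda>t. \<Sum>k<N. f k t) has_integral (\<Sum>k<N. I k)) {a..b}" for N
    by (intro has_integral_sum integral) simp
  hence "J = (\<lambda>N. \<Sum>k<N. I k)"
    by (intro ext has_integral_unique[OF J])
  hence "J \<longlonglongrightarrow> S"
    using sums unfolding sums_def by simp
  hence "L = S"
    by (rule LIMSEQ_unique[OF lim])
  with L show ?thesis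
    by simp
qed

lemma has_integral_exp_series_times_exp_poly:
  fixes a :: "nat \<Rightarrow> complex" and c :: "int \<Rightarrow> complex"
  assumes "finite J" and summable: "summable (\<lambda>k. norm (a k) * exp (- (e * real k)))"
  shows "((\<lambda>t. (\<Sum>k. a k * exp (- (of_nat k * Complex e t))) * (\<Sum>j\<in>J. c j * exp (of_int j * Complex e t)))
           has_integral of_real (2 * pi) * (\<Sum>k | int k \<in> J. a k * c (int k))) {- pi..pi}"
proof -
  define G where "G = (\<lambda>t. \<Sum>j\<in>J. c j * exp (of_int j * Complex e t))"
  define f where "f = (\<lambda>k t. a k * exp (- (of_nat k * Complex e t)))"
  define B where "B = (\<Sum>j\<in>J. norm (c j) * exp (of_int j * e))"
  define I where "I = (\<lambda>k. if k \<in> int -` J then of_real (2 * pi) * (a k * c (int k)) else 0)"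
  have norm_f: "norm (f k t) = norm (a k) * exp (- (e * real k))" for k t
    by (simp add: f_def norm_mult mult.commute)
  have "norm (G t) \<le> B" for t
    unfolding G_def B_def by (rule sum_norm_le) (simp add: norm_mult)
  hence bound: "norm (f k t * G t) \<le> norm (a k) * exp (- (e * real k)) * B" for k t
    unfolding norm_mult norm_f by (intro mult_left_mono) auto
  have integral: "((\<lambda>t. f k t * G t) has_integral I k) {- pi..pi}" for k
    using has_integral_mult_right[OF has_integral_exp_times_exp_poly[OF assms(1), of "int k" e c], of "a k"]
    by (cases "int k \<in> J") (simp_all add: f_def G_def I_def mult_ac)
  have cont: "continuous_on {- pi..pi} (\<lambda>t. f k t * G t)" for k
    unfolding f_def G_def Complex_eq by (intro continuous_intros)
  have "finite (int -` J)"
    using assms(1) by (intro finite_vimageI) auto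
  hence "I sums (\<Sum>k\<in>int -` J. of_real (2 * pi) * (a k * c (int k)))"
    unfolding I_def by (rule sums_If_finite_set)
  hence "I sums (of_real (2 * pi) * (\<Sum>k | int k \<in> J. a k * c (int k)))"
    by (simp only: sum_distrib_left vimage_def)
  with cont bound summable_mult2[OF summable] integral
  have "((\<lambda>t. \<Sum>k. f k t * G t) has_integral of_real (2 * pi) * (\<Sum>k | int k \<in> J. a k * c (int k))) {- pi..pi}"
    by (rule has_integral_suminf)
  moreover have "summable (\<lambda>k. f k t)" for t
    by (rule summable_norm_cancel) (simp only: norm_f summable)
  hence "(\<Sum>k. f k t * G t) = (\<Sum>k. f k t) * G t" for t
    by (simp only: suminf_mult2)
  ultimately show ?thesis
    by (simp only: f_def G_def)
qed

section \<open>The weighted binomial generating function\<close>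

definition central_choose :: "nat \<Rightarrow> int \<Rightarrow> nat" where
  "central_choose n k = (2 * n) choose (n + nat \<bar>k\<bar>)"

lemma sum_central_choose_exp:
  fixes s :: complex
  assumes "m \<le> n"
  shows "(\<Sum>k=- int n..int n. of_nat (central_choose m k) * exp (of_int k * s))
       = (2 * cosh (s / 2)) ^ (2 * m)"
proof -
  have "(\<Sum>k=- int n..int n. of_nat (central_choose m k) * exp (of_int k * s))
      = (\<Sum>k=- int m..int m. of_nat (central_choose m k) * exp (of_int k * s))"
    using assms by (intro sum.mono_neutral_right) (auto simp: central_choose_def intro!: binomial_eq_0)
  also have "\<dots> = (\<Sum>j\<le>2 * m. of_nat ((2 * m) choose j) * exp (s / 2) ^ j * exp (- (s / 2)) ^ (2 * m - j))"
  proof (rule sum.reindex_bij_witness[where i = "\<lambda>j. int j - int m" and j = "\<lambda>k. nat (k + int m)"])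
    fix k assume "k \<in> {- int m..int m}"
    then obtain j where j: "j \<le> 2 * m" "k = int j - int m"
      by (intro that[of "nat (k + int m)"]) auto
    have "central_choose m k = (2 * m) choose j"
    proof (cases "m \<le> j")
      case True
      thus ?thesis
        by (simp add: central_choose_def j nat_diff_distrib)
    next
      case False
      hence reflect: "m + nat \<bar>k\<bar> = 2 * m - j"
        by (simp add: j)
      show ?thesis
        unfolding central_choose_def reflect using j(1) by (rule binomial_symmetric[symmetric])
    qed
    moreover have "exp (s / 2) ^ j * exp (- (s / 2)) ^ (2 * m - j) = exp (of_int k * s)"
      unfolding exp_of_nat_mult[symmetric] exp_add[symmetric] j(2)
      using j(1) by (intro arg_cong[where f = exp]) (simp add: of_nat_diff field_simps)
    ultimately show "of_nat ((2 * m) choose nat (k + int m)) * exp (s / 2) ^ nat (k + int m)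
        * exp (- (s / 2)) ^ (2 * m - nat (k + int m)) = of_nat (central_choose m k) * exp (of_int k * s)"
      by (simp add: j(2) mult.assoc)
  qed auto
  also have "\<dots> = (exp (s / 2) + exp (- (s / 2))) ^ (2 * m)"
    by (simp only: binomial_ring)
  also have "exp (s / 2) + exp (- (s / 2)) = 2 * cosh (s / 2)"
    by (simp add: cosh_field_def)
  finally show ?thesis .
qed

lemma sum_int_times_central_choose_exp:
  fixes s :: complex
  assumes "m \<le> n"
  shows "(\<Sum>k=- int n..int n. of_int k * of_nat (central_choose m k) * exp (of_int k * s))
       = 2 * of_nat m * (2 * cosh (s / 2)) ^ (2 * m - 1) * sinh (s / 2)"
proof (rule DERIV_unique)
  show "((\<lambda>s. \<Sum>k=- int n..int n. of_nat (central_choose m k) * exp (of_int k * s)) has_field_derivative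
      (\<Sum>k=- int n..int n. of_int k * of_nat (central_choose m k) * exp (of_int k * s))) (at s)"
    by (intro DERIV_sum) (auto intro!: derivative_eq_intros)
  show "((\<lambda>s. \<Sum>k=- int n..int n. of_nat (central_choose m k) * exp (of_int k * s)) has_field_derivative
      2 * of_nat m * (2 * cosh (s / 2)) ^ (2 * m - 1) * sinh (s / 2)) (at s)"
  proof -
    have "((\<lambda>s. 2 * cosh (s / 2)) has_field_derivative sinh (s / 2)) (at s)"
      by (auto intro!: derivative_eq_intros)
    from DERIV_power[OF this, of "2 * m"] show ?thesis
      unfolding sum_central_choose_exp[OF assms] by (simp add: mult_ac)
  qed
qed

lemma central_choose_descend:
  "((real n)\<^sup>2 - (of_int k)\<^sup>2) * real (central_choose n k)
     = 2 * real n * (2 * real n - 1) * real (central_choose (n - 1) k)"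
proof -
  define j where "j = nat \<bar>k\<bar>"
  have "((real n)\<^sup>2 - (real j)\<^sup>2) * real ((2 * n) choose (n + j))
      = 2 * real n * (2 * real n - 1) * real ((2 * (n - 1)) choose (n - 1 + j))"
  proof (cases "0 < n \<and> j \<le> n")
    case True
    have "(n + j) * ((2 * n) choose (n + j)) = 2 * n * ((2 * n - 1) choose (n + j - 1))"
      using True by (intro times_binomial_minus1_eq) simp
    moreover have "(2 * n - 1 - (n + j - 1)) * ((2 * n - 1) choose (n + j - 1))
        = (2 * n - 1) * ((2 * n - 1 - 1) choose (n + j - 1))"
      by (rule binomial_absorb_comp)
    moreover have "2 * n - 1 - (n + j - 1) = n - j" "2 * n - 1 - 1 = 2 * (n - 1)" "n + j - 1 = n - 1 + j"
      using True by auto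
    ultimately have "(n - j) * ((n + j) * ((2 * n) choose (n + j)))
        = 2 * n * ((2 * n - 1) * ((2 * (n - 1)) choose (n - 1 + j)))"
      by (simp only: mult.left_commute[of "n - j"])
    hence "real ((n - j) * ((n + j) * ((2 * n) choose (n + j))))
        = real (2 * n * ((2 * n - 1) * ((2 * (n - 1)) choose (n - 1 + j))))"
      by (rule arg_cong)
    moreover have "(real n)\<^sup>2 - (real j)\<^sup>2 = real (n - j) * real (n + j)"
      using True by (simp add: of_nat_diff power2_eq_square algebra_simps)
    ultimately show ?thesis
      using True by (simp add: of_nat_diff mult.assoc)
  qed (auto simp: binomial_eq_0)
  thus ?thesis
    by (simp add: central_choose_def j_def)
qed

lemma central_choose_Suc:
  "(real n + real k + 1) * real (central_choose n (int k + 1))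
     = (real n - real k) * real (central_choose n (int k))"
proof (cases "k \<le> n")
  case True
  have "Suc (n + k) * ((2 * n) choose Suc (n + k)) = (2 * n - (n + k)) * ((2 * n) choose (n + k))"
    by (simp only: binomial_absorption binomial_absorb_comp)
  hence "real (Suc (n + k)) * real ((2 * n) choose Suc (n + k))
      = real (2 * n - (n + k)) * real ((2 * n) choose (n + k))"
    by (metis of_nat_mult)
  thus ?thesis
    using True by (simp add: central_choose_def nat_add_distrib of_nat_diff algebra_simps)
qed (simp add: central_choose_def nat_add_distrib binomial_eq_0)

lemma central_binomial_ge:
  assumes "n \<ge> 1"
  shows "4 ^ n \<le> 2 * sqrt (real n) * real ((2 * n) choose n)"
proof -
  have "(4 ^ n)\<^sup>2 \<le> 4 * real n * (real ((2 * n) choose n))\<^sup>2"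
    using assms
  proof (induction n rule: nat_induct_at_least)
    case base
    show ?case
      by (simp add: numeral_2_eq_2)
  next
    case (Suc n)
    define x where "x = real n"
    define b where "b = real ((2 * n) choose n)"
    define c where "c = real ((2 * Suc n) choose Suc n)"
    have "x \<ge> 1"
      using Suc.hyps by (simp add: x_def)
    have "(x + 1)\<^sup>2 * c = 2 * (x + 1) * (2 * x + 1) * b"
      using central_choose_descend[of "Suc n" 0]
      by (simp add: central_choose_def x_def b_def c_def add_ac
          del: binomial_Suc_Suc mult_Suc_right mult_Suc)
    hence "(x + 1) * ((x + 1) * c) = (x + 1) * (2 * (2 * x + 1) * b)"
      by (simp only: power2_eq_square mult_ac)
    hence c_eq: "(x + 1) * c = 2 * (2 * x + 1) * b"
      by (rule mult_left_cancel[THEN iffD1, rotated]) (use \<open>x \<ge> 1\<close> in simp)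
    have "4 * (x * (x + 1)) * b\<^sup>2 \<le> (2 * x + 1)\<^sup>2 * b\<^sup>2"
      by (intro mult_right_mono) (auto simp: power2_eq_square algebra_simps)
    hence "16 * x * (4 * (x * (x + 1)) * b\<^sup>2) \<le> 16 * x * ((2 * x + 1)\<^sup>2 * b\<^sup>2)"
      using \<open>x \<ge> 1\<close> by (intro mult_left_mono) auto
    also have "\<dots> = 4 * x * ((x + 1) * c)\<^sup>2"
      unfolding c_eq by algebra
    finally have "x * (x + 1) * (16 * (4 * x * b\<^sup>2)) \<le> x * (x + 1) * (4 * (x + 1) * c\<^sup>2)"
      by (simp add: power2_eq_square mult_ac)
    hence "16 * (4 * x * b\<^sup>2) \<le> 4 * (x + 1) * c\<^sup>2"
      by (rule mult_left_le_imp_le) (use \<open>x \<ge> 1\<close> in auto)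
    moreover have "(4 ^ Suc n)\<^sup>2 \<le> 16 * (4 * x * b\<^sup>2)"
      using Suc.IH by (simp add: x_def b_def power_mult_distrib)
    ultimately show ?case
      by (simp add: c_def x_def add.commute)
  qed
  also have "\<dots> = (2 * sqrt (real n) * real ((2 * n) choose n))\<^sup>2"
    by (simp add: power_mult_distrib)
  finally show ?thesis
    by (rule power2_le_imp_le) simp
qed

definition bin_weight :: "nat \<Rightarrow> int \<Rightarrow> real" where
  "bin_weight n k = of_int k * ((of_int k)\<^sup>2 - 3 * real n + 2) * (2 * (of_int k)\<^sup>2 - real n)
      * real (central_choose n k)"

lemma bin_weight_minus [simp]: "bin_weight n (- k) = - bin_weight n k"
  by (simp add: bin_weight_def central_choose_def)

lemma bin_weight_0 [simp]: "bin_weight n 0 = 0"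
  by (simp add: bin_weight_def)

lemma F_eq_sum_bin_weight: "real_of_int (F n) = (\<Sum>k\<le>n. real (sigma k) * bin_weight n (int k))"
proof -
  have "(2 * n) choose (n - k) = (2 * n) choose (n + k)" if "k \<le> n" for k
    using binomial_symmetric[of "n - k" "2 * n"] that by simp
  hence "real_of_int (F n) = (\<Sum>k=1..n. real (sigma k) * bin_weight n (int k))"
    by (simp add: F_def bin_weight_def central_choose_def mult_ac)
  also have "\<dots> = (\<Sum>k\<le>n. real (sigma k) * bin_weight n (int k))"
    by (intro sum.mono_neutral_left) (auto simp: sigma_0 not_less_eq_eq)
  finally show ?thesis .
qed

definition bin_gen :: "nat \<Rightarrow> complex \<Rightarrow> complex" where
  "bin_gen n s = (\<Sum>k=- int n..int n. of_real (bin_weight n k) * exp (of_int k * s))"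

text \<open>In the basis \<open>1\<close>, \<open>n\<^sup>2 - k\<^sup>2\<close>, \<open>(n\<^sup>2 - k\<^sup>2) ((n - 1)\<^sup>2 - k\<^sup>2)\<close> the polynomial weight just lowers \<open>n\<close> in
  the binomial coefficient.\<close>

lemma bin_weight_eq:
  fixes n :: nat and k :: int
  assumes "n \<ge> 1"
  defines "x \<equiv> real n"
  shows "bin_weight n k = of_int k * (x * (x - 1) * (x - 2) * (2 * x - 1) * real (central_choose n k)
           - (x - 2) * (4 * x - 3) * (2 * x * (2 * x - 1)) * real (central_choose (n - 1) k)
           + 2 * (2 * x * (2 * x - 1)) * ((2 * x - 2) * (2 * x - 3)) * real (central_choose (n - 2) k))"
proof -
  define K where "K = (real_of_int k)\<^sup>2"
  define C where "C = (\<lambda>j. real (central_choose j k))"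
  have descend: "(x\<^sup>2 - K) * C n = 2 * x * (2 * x - 1) * C (n - 1)"
    unfolding x_def K_def C_def by (rule central_choose_descend)
  have "real (n - 1) = x - 1" "n - 1 - 1 = n - 2"
    using assms(1) by (simp_all add: x_def of_nat_diff)
  hence "((x - 1)\<^sup>2 - K) * C (n - 1) = 2 * (x - 1) * (2 * (x - 1) - 1) * C (n - 2)"
    using central_choose_descend[of "n - 1" k] unfolding K_def C_def by simp
  hence descend_twice: "((x - 1)\<^sup>2 - K) * C (n - 1) = (2 * x - 2) * (2 * x - 3) * C (n - 2)"
    by (simp add: right_diff_distrib)
  have "(K - 3 * x + 2) * (2 * K - x) * C n
      = x * (x - 1) * (x - 2) * (2 * x - 1) * C n - (x - 2) * (4 * x - 3) * ((x\<^sup>2 - K) * C n)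
        + 2 * (((x - 1)\<^sup>2 - K) * ((x\<^sup>2 - K) * C n))"
    by algebra
  also have "((x - 1)\<^sup>2 - K) * ((x\<^sup>2 - K) * C n) = 2 * x * (2 * x - 1) * (((x - 1)\<^sup>2 - K) * C (n - 1))"
    unfolding descend by (rule mult.left_commute)
  finally have "(K - 3 * x + 2) * (2 * K - x) * C n = x * (x - 1) * (x - 2) * (2 * x - 1) * C n
      - (x - 2) * (4 * x - 3) * (2 * x * (2 * x - 1)) * C (n - 1)
      + 2 * (2 * x * (2 * x - 1)) * ((2 * x - 2) * (2 * x - 3)) * C (n - 2)"
    unfolding descend descend_twice by (simp only: mult.assoc)
  moreover have "bin_weight n k = of_int k * ((K - 3 * x + 2) * (2 * K - x) * C n)"
    by (simp add: bin_weight_def C_def x_def K_def mult.assoc)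
  ultimately show ?thesis
    by (simp add: C_def)
qed

lemma bin_gen_eq_sinh_cosh:
  assumes "n \<ge> 3"
  shows "bin_gen n s = of_real (real n * (real n - 1) * (real n - 2) * (2 * real n - 1)) * 4 ^ n *
    (sinh (s / 2) ^ 3 * cosh (s / 2) ^ (2 * n - 5) * (3 / 2 + of_nat n * (sinh (s / 2))\<^sup>2))"
proof -
  define x where "x = complex_of_nat n"
  define S C where "S = sinh (s / 2)" and "C = 2 * cosh (s / 2)"
  define y where "y = C ^ (2 * n - 5)"
  define D where "D = (\<lambda>m. \<Sum>k=- int n..int n. of_int k * of_nat (central_choose m k) * exp (of_int k * s))"
  have D: "D m = 2 * of_nat m * C ^ (2 * m - 1) * S" if "m \<le> n" for m
    unfolding D_def C_def S_def by (rule sum_int_times_central_choose_exp[OF that])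
  have exponents: "2 * n - 1 = 4 + (2 * n - 5)" "2 * (n - 1) - 1 = 2 + (2 * n - 5)"
    "2 * (n - 2) - 1 = 2 * n - 5"
    using assms by auto
  have D_eq: "D n = 2 * x * (C ^ 4 * y) * S" "D (n - 1) = 2 * (x - 1) * (C\<^sup>2 * y) * S"
    "D (n - 2) = 2 * (x - 2) * y * S"
    using assms by (simp_all only: D diff_le_self exponents power_add x_def y_def of_nat_diff) simp_all
  define a where "a = x * (x - 1) * (x - 2) * (2 * x - 1)"
  define b where "b = (x - 2) * (4 * x - 3) * (2 * x * (2 * x - 1))"
  define c where "c = 2 * (2 * x * (2 * x - 1)) * ((2 * x - 2) * (2 * x - 3))"
  have weight: "of_real (bin_weight n k) = of_int k * (a * of_nat (central_choose n k)
      - b * of_nat (central_choose (n - 1) k) + c * of_nat (central_choose (n - 2) k))" for k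
    using assms by (subst bin_weight_eq) (simp_all add: a_def b_def c_def x_def)
  have "bin_gen n s = a * D n - b * D (n - 1) + c * D (n - 2)"
    unfolding bin_gen_def D_def sum_distrib_left sum_subtractf[symmetric] sum.distrib[symmetric]
    by (intro sum.cong refl)
      (simp only: weight distrib_left distrib_right left_diff_distrib right_diff_distrib mult_ac)
  also have "\<dots> = a * 2 * S * y * (x * C ^ 4 - 2 * (4 * x - 3) * C\<^sup>2 + 8 * (2 * x - 3))"
    unfolding D_eq a_def b_def c_def by algebra
  also have "x * C ^ 4 - 2 * (4 * x - 3) * C\<^sup>2 + 8 * (2 * x - 3) = 16 * S\<^sup>2 * (3 / 2 + x * S\<^sup>2)"
  proof -
    have C_sq: "C\<^sup>2 = 4 * (1 + S\<^sup>2)"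
      using cosh_square_eq[of "s / 2"] by (simp add: C_def S_def power_mult_distrib)
    have "C ^ 4 = (C\<^sup>2)\<^sup>2"
      by (simp flip: power_mult)
    thus ?thesis
      unfolding C_sq by algebra
  qed
  also have "y = 2 ^ (2 * n - 5) * cosh (s / 2) ^ (2 * n - 5)"
    by (simp add: y_def C_def power_mult_distrib)
  also have "a * 2 * S * (2 ^ (2 * n - 5) * cosh (s / 2) ^ (2 * n - 5)) * (16 * S\<^sup>2 * (3 / 2 + x * S\<^sup>2))
      = a * 2 ^ (5 + (2 * n - 5)) * (S ^ 3 * cosh (s / 2) ^ (2 * n - 5) * (3 / 2 + x * S\<^sup>2))"
    by (simp add: power_add power2_eq_square power3_eq_cube)
  also have "5 + (2 * n - 5) = 2 * n"
    using assms by simp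
  finally show ?thesis
    by (simp add: a_def x_def S_def power_mult)
qed

lemma sum_telescope_central_choose:
  fixes q :: "real \<Rightarrow> real"
  assumes "q 0 = 0" and "\<And>k. f k = q k * (real n + k) - q (k + 1) * (real n - k)"
  shows "(\<Sum>k\<le>n. f (real k) * real (central_choose n (int k))) = 0"
proof -
  define Z where "Z = (\<lambda>k. q (real k) * (real n + real k) * real (central_choose n (int k)))"
  have "f (real k) * real (central_choose n (int k)) = Z k - Z (Suc k)" for k
  proof -
    have "Z (Suc k) = q (real k + 1) * ((real n + real k + 1) * real (central_choose n (int k + 1)))"
      by (simp add: Z_def algebra_simps)
    also have "\<dots> = q (real k + 1) * (real n - real k) * real (central_choose n (int k))"
      unfolding central_choose_Suc by simp
    finally show ?thesis
      by (simp add: assms(2) Z_def left_diff_distrib)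
  qed
  hence "(\<Sum>k\<le>n. f (real k) * real (central_choose n (int k))) = (\<Sum>k<Suc n. Z k - Z (Suc k))"
    by (simp only: lessThan_Suc_atMost)
  also have "\<dots> = Z 0 - Z (Suc n)"
    by (rule sum_lessThan_telescope')
  finally show ?thesis
    using assms(1) by (simp add: Z_def central_choose_def binomial_eq_0)
qed

text \<open>The telescoping certificates in the next two lemmas come from Gosper's algorithm.\<close>

lemma sum_bin_weight_eq_0: "(\<Sum>k\<le>n. bin_weight n (int k)) = 0"
proof -
  have "(\<Sum>k\<le>n. (real k * ((real k)\<^sup>2 - 3 * real n + 2) * (2 * (real k)\<^sup>2 - real n))
      * real (central_choose n (int k))) = 0"
    by (rule sum_telescope_central_choose[where
      q = "\<lambda>k. k ^ 4 - 2 * k ^ 3 - (3 * real n / 2 - 2) * k\<^sup>2 + (3 * real n / 2 - 1) * k"])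
      (simp_all add: field_simps eval_nat_numeral)
  thus ?thesis
    by (simp add: bin_weight_def)
qed

lemma sum_times_bin_weight_eq_0: "(\<Sum>k\<le>n. real k * bin_weight n (int k)) = 0"
proof -
  have "(\<Sum>k\<le>n. ((real k)\<^sup>2 * ((real k)\<^sup>2 - 3 * real n + 2) * (2 * (real k)\<^sup>2 - real n))
      * real (central_choose n (int k))) = 0"
    by (rule sum_telescope_central_choose[where
      q = "\<lambda>k. k ^ 5 - 5 / 2 * k ^ 4 - (real n - 2) * k ^ 3 + (3 * real n - 1) / 2 * k\<^sup>2
        - real n / 2 * k"])
      (simp_all add: field_simps eval_nat_numeral)
  moreover have "real k * bin_weight n (int k)
      = ((real k)\<^sup>2 * ((real k)\<^sup>2 - 3 * real n + 2) * (2 * (real k)\<^sup>2 - real n))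
        * real (central_choose n (int k))" for k
    by (simp add: bin_weight_def power2_eq_square)
  ultimately show ?thesis
    by simp
qed

section \<open>Removing the poles of the generating function\<close>

definition reduced_sigma :: "nat \<Rightarrow> real" where
  "reduced_sigma k = real (sigma k) - pi\<^sup>2 / 6 * real k + 1 / 2"

definition reduced_series :: "complex \<Rightarrow> complex" where
  "reduced_series s = (\<Sum>k. of_real (reduced_sigma k) * exp (- (of_nat k * s)))"

lemma reduced_series_eq:
  assumes "Re s > 0"
  shows "reduced_series s = sigma_series s - of_real (pi\<^sup>2 / 6) * half_csch_sq s + half_coth s / 2 + 1 / 4"
proof -
  define q where "q = exp (- s)"
  have "norm q < 1"
    using assms by (simp add: q_def)
  hence "q \<noteq> 1"
    by auto
  have q_power: "q ^ k = exp (- (of_nat k * s))" for k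
    unfolding q_def exp_of_nat_mult[symmetric] by simp
  have "summable (\<lambda>k. norm (of_nat (sigma k) * exp (- (of_nat k * s))))"
    using summable_sigma_times_exp_minus[OF assms] by (simp add: norm_mult mult.commute)
  hence sigma_sums: "(\<lambda>k. of_nat (sigma k) * exp (- (of_nat k * s))) sums sigma_series s"
    unfolding sigma_series_def by (rule summable_sums[OF summable_norm_cancel])
  have "(\<lambda>k. exp (- (of_nat k * s))) sums (1 / (1 - q))"
    using geometric_sums[OF \<open>norm q < 1\<close>] by (simp only: q_power)
  also have "1 / (1 - q) = half_coth s + 1 / 2"
    using \<open>q \<noteq> 1\<close> by (simp add: half_coth_conv_exp q_def divide_simps)
  finally have "(\<lambda>k. of_nat (sigma k) * exp (- (of_nat k * s))
      - of_real (pi\<^sup>2 / 6) * (of_nat k * exp (- (of_nat k * s))) + 1 / 2 * exp (- (of_nat k * s))) sums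
      (sigma_series s - of_real (pi\<^sup>2 / 6) * half_csch_sq s + 1 / 2 * (half_coth s + 1 / 2))"
    by (intro sums_add sums_diff sums_mult sigma_sums sums_half_csch_sq_exp assms)
  thus ?thesis
    unfolding reduced_series_def reduced_sigma_def by (simp add: sums_iff algebra_simps)
qed

lemma summable_reduced_sigma_times_exp_minus:
  assumes "e > 0"
  shows "summable (\<lambda>k. norm (complex_of_real (reduced_sigma k)) * exp (- (e * real k)))"
proof (rule summable_comparison_test')
  show "summable (\<lambda>k. real (sigma k) * exp (- (e * real k)) + pi\<^sup>2 / 6 * (real k ^ 1 * exp (- (e * real k)))
      + 1 / 2 * (real k ^ 0 * exp (- (e * real k))))"
    using assms
    by (intro summable_add summable_mult summable_sigma_times_exp_minus summable_power_times_exp_minus)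
  show "norm (norm (complex_of_real (reduced_sigma k)) * exp (- (e * real k)))
      \<le> real (sigma k) * exp (- (e * real k)) + pi\<^sup>2 / 6 * (real k ^ 1 * exp (- (e * real k)))
        + 1 / 2 * (real k ^ 0 * exp (- (e * real k)))" for k
  proof -
    have "\<bar>reduced_sigma k\<bar> \<le> real (sigma k) + pi\<^sup>2 / 6 * real k + 1 / 2"
      unfolding reduced_sigma_def by (simp add: abs_le_iff)
    hence "\<bar>reduced_sigma k\<bar> * exp (- (e * real k))
        \<le> (real (sigma k) + pi\<^sup>2 / 6 * real k + 1 / 2) * exp (- (e * real k))"
      by (rule mult_right_mono) simp
    thus ?thesis
      by (simp add: algebra_simps)
  qed
qed

lemma sum_reduced_sigma_times_bin_weight:
  "(\<Sum>k\<le>n. reduced_sigma k * bin_weight n (int k)) = real_of_int (F n)"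
proof -
  have "(\<Sum>k\<le>n. reduced_sigma k * bin_weight n (int k))
      = real_of_int (F n) - pi\<^sup>2 / 6 * (\<Sum>k\<le>n. real k * bin_weight n (int k))
        + 1 / 2 * (\<Sum>k\<le>n. bin_weight n (int k))"
    unfolding F_eq_sum_bin_weight sum_distrib_left sum_subtractf[symmetric] sum.distrib[symmetric]
    by (simp add: reduced_sigma_def algebra_simps)
  thus ?thesis
    by (simp add: sum_bin_weight_eq_0 sum_times_bin_weight_eq_0)
qed

lemma has_integral_reduced_series_times_bin_gen:
  assumes "e > 0"
  shows "((\<lambda>t. reduced_series (Complex e t) * bin_gen n (Complex e t)) has_integral
           of_real (2 * pi * real_of_int (F n))) {- pi..pi}"
proof -
  have "{k. int k \<in> {- int n..int n}} = {..n}"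
    by auto
  hence "(\<Sum>k | int k \<in> {- int n..int n}. of_real (reduced_sigma k) * of_real (bin_weight n (int k)))
      = complex_of_real (real_of_int (F n))"
    unfolding sum_reduced_sigma_times_bin_weight[symmetric] by simp
  thus ?thesis
    using has_integral_exp_series_times_exp_poly[of "{- int n..int n}" "\<lambda>k. of_real (reduced_sigma k)" e
        "\<lambda>k. of_real (bin_weight n k)"]
      summable_reduced_sigma_times_exp_minus[OF assms]
    by (simp add: reduced_series_def bin_gen_def)
qed

definition trig_approx :: "complex \<Rightarrow> complex" where
  "trig_approx s = of_real (pi\<^sup>2 / 6) * cosh_approx s + sinh_approx s + 7 / 24"

lemma norm_reduced_series_minus_trig_approx_le:
  assumes "0 < Re s" "Re s \<le> 1/50" "\<bar>Im s\<bar> \<le> pi"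
  shows "norm (reduced_series s - trig_approx s) \<le> norm s ^ 5 / 29 + 24 * (norm s / pi) ^ 18 / Re s ^ 10"
proof -
  have s: "s \<noteq> 0" "\<bar>Re s\<bar> \<le> 1/50"
    using assms by auto
  define E where "E = 1 / s\<^sup>2 - half_csch_sq s - cosh_approx s"
  define U where "U = (half_coth s - 1 / s) / 2 - sinh_approx s"
  define P where "P = 4 * of_real pi ^ 2 / s\<^sup>2 * sigma_series (4 * of_real pi ^ 2 / s)"
  have "pi\<^sup>2 \<le> 3.1416\<^sup>2"
    using pi_approx by (intro power_mono) auto
  hence pi_sq: "norm (complex_of_real (pi\<^sup>2 / 6)) \<le> 5 / 3"
    unfolding norm_of_real by (simp add: power2_eq_square)
  have "norm E \<le> norm s ^ 6 / 700"
    unfolding E_def by (rule half_csch_sq_cosh_approximation[OF s assms(3)])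
  also have "\<dots> \<le> 16 / 5 * norm s ^ 5 / 700"
    using mult_right_mono[OF norm_le_in_strip[OF s(2) assms(3)], of "norm s ^ 5"]
    by (simp add: eval_nat_numeral)
  finally have E: "norm E \<le> 16 / 5 * norm s ^ 5 / 700" .
  have U: "norm U \<le> norm s ^ 5 / 38"
    unfolding U_def by (rule half_coth_sinh_approximation[OF s assms(3)])
  have P: "norm P \<le> 24 * (norm s / pi) ^ 18 / Re s ^ 10"
    unfolding P_def by (rule norm_sigma_series_dual_le[OF assms(1)])
  have "reduced_series s - trig_approx s = of_real (pi\<^sup>2 / 6) * E + U - P"
    unfolding reduced_series_eq[OF assms(1)] sigma_series_transformation[OF assms(1)]
      trig_approx_def E_def U_def P_def
    by (simp add: algebra_simps diff_divide_distrib)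
  also have "norm \<dots> \<le> 5 / 3 * (16 / 5 * norm s ^ 5 / 700) + norm s ^ 5 / 38
      + 24 * (norm s / pi) ^ 18 / Re s ^ 10"
    unfolding norm_mult[of _ E, symmetric]
    by (intro norm_triangle_mono norm_diff_mono U P) (simp only: norm_mult, intro mult_mono pi_sq E; simp)
  also have "5 / 3 * (16 / 5 * norm s ^ 5 / 700) + norm s ^ 5 / 38 \<le> norm s ^ 5 / 29"
    by simp
  finally show ?thesis
    by simp
qed

definition main_combination :: "nat \<Rightarrow> real" where
  "main_combination n = - 41 / 720 * bin_weight n 1 + 11 / 1440 * bin_weight n 2"

lemma has_integral_trig_approx_times_bin_gen:
  assumes "n \<ge> 2"
  shows "((\<lambda>t. trig_approx (Complex e t) * bin_gen n (Complex e t)) has_integral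
     of_real (2 * pi * main_combination n)) {- pi..pi}"
proof -
  define P where "P = complex_of_real (pi\<^sup>2 / 6)"
  define c where "c = (\<lambda>k::int. if k = 0 then P * (191 / 2016) + 7 / 24
      else if k = 1 then - P * (47 / 7560) - 41 / 1440 else if k = - 1 then - P * (47 / 7560) + 41 / 1440
      else if k = 2 then P * (31 / 60480) + 11 / 2880 else P * (31 / 60480) - 11 / 2880)"
  define J where "J = {0, 1, - 1, 2, - 2 :: int}"
  have "((\<lambda>t. \<Sum>k\<in>J. c k * (exp (- (of_int k * Complex e t)) * bin_gen n (Complex e t))) has_integral
     (\<Sum>k\<in>J. c k * (of_real (2 * pi) *
        (if k \<in> {- int n..int n} then of_real (bin_weight n k) else 0)))) {- pi..pi}"
    unfolding bin_gen_def
    by (intro has_integral_sum has_integral_mult_right has_integral_exp_times_exp_poly) (auto simp: J_def)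
  moreover have "trig_approx s = (\<Sum>k\<in>J. c k * exp (- (of_int k * s)))" for s
    unfolding trig_approx_def cosh_approx_def sinh_approx_def P_def[symmetric]
    by (simp add: J_def c_def cosh_field_def sinh_field_def field_simps)
  moreover have "(\<Sum>k\<in>J. c k * (of_real (2 * pi) *
        (if k \<in> {- int n..int n} then of_real (bin_weight n k) else 0)))
      = of_real (2 * pi * main_combination n)"
    using assms by (simp add: J_def c_def main_combination_def field_simps)
  ultimately show ?thesis
    by (simp only: sum_distrib_right mult.assoc)
qed

section \<open>Estimates on the vertical line\<close>

lemma norm_sinh_le_2:
  fixes z :: complex
  assumes "\<bar>Re z\<bar> \<le> 1/2"
  shows "norm (sinh z) \<le> 2"
proof -
  have "exp (Re z) \<le> 2" "exp (- Re z) \<le> 2"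
    using assms exp_half_le2 by (meson abs_le_iff exp_le_cancel_iff order_trans)+
  thus ?thesis
    using norm_triangle_ineq4[of "exp z" "exp (- z)"] by (simp add: sinh_field_def norm_divide)
qed

lemma norm_cosh_le_exp:
  fixes z :: complex
  shows "norm (cosh z) \<le> exp ((sinh (Re z))\<^sup>2 - (norm (sinh z))\<^sup>2 / 2)"
proof -
  have "(norm (cosh z))\<^sup>2 = 1 + (2 * (sinh (Re z))\<^sup>2 - (norm (sinh z))\<^sup>2)"
    by (simp add: norm_cosh_squared norm_sinh_squared cos_squared_eq)
  also have "\<dots> \<le> exp (2 * (sinh (Re z))\<^sup>2 - (norm (sinh z))\<^sup>2)"
    by (rule exp_ge_add_one_self)
  also have "\<dots> = (exp ((sinh (Re z))\<^sup>2 - (norm (sinh z))\<^sup>2 / 2))\<^sup>2"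
    by (simp add: right_diff_distrib flip: exp_double)
  finally show ?thesis
    by (rule power2_le_imp_le) simp
qed

definition gaussian_profile :: "nat \<Rightarrow> real \<Rightarrow> real" where
  "gaussian_profile n w = w ^ 3 * (3 / 2 + real n * w\<^sup>2) * exp (- (real n - 5 / 2) * w\<^sup>2)"

lemma norm_bin_gen_le:
  fixes s :: complex
  assumes "n \<ge> 3"
  defines "w \<equiv> norm (sinh (s / 2))"
  shows "norm (bin_gen n s) \<le> 2 * real n ^ 4 * 4 ^ n * exp ((2 * real n - 5) * (sinh (Re s / 2))\<^sup>2)
           * gaussian_profile n w"
proof -
  define K where "K = real n * (real n - 1) * (real n - 2) * (2 * real n - 1)"
  have "K \<le> real n * real n * real n * (2 * real n)" "0 \<le> K"
    unfolding K_def using assms(1) by (intro mult_mono mult_nonneg_nonneg; simp)+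
  hence K: "0 \<le> K" "K \<le> 2 * real n ^ 4"
    by (simp_all add: eval_nat_numeral)
  have "norm (cosh (s / 2)) ^ (2 * n - 5) \<le> exp ((sinh (Re s / 2))\<^sup>2 - w\<^sup>2 / 2) ^ (2 * n - 5)"
    using norm_cosh_le_exp[of "s / 2"] by (intro power_mono) (simp_all add: w_def)
  also have "\<dots> = exp ((2 * real n - 5) * (sinh (Re s / 2))\<^sup>2) * exp (- (real n - 5 / 2) * w\<^sup>2)"
    unfolding exp_of_nat_mult[symmetric] exp_add[symmetric]
    using assms(1) by (intro arg_cong[where f = exp]) (simp add: of_nat_diff algebra_simps)
  finally have cosh_power: "norm (cosh (s / 2)) ^ (2 * n - 5)
      \<le> exp ((2 * real n - 5) * (sinh (Re s / 2))\<^sup>2) * exp (- (real n - 5 / 2) * w\<^sup>2)" .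
  have bracket: "norm (3 / 2 + of_nat n * (sinh (s / 2))\<^sup>2) \<le> 3 / 2 + real n * w\<^sup>2"
    by (intro norm_triangle_mono) (simp_all add: norm_mult norm_power w_def)
  have "norm (bin_gen n s) = K * 4 ^ n * (w ^ 3 * norm (3 / 2 + of_nat n * (sinh (s / 2))\<^sup>2))
      * norm (cosh (s / 2)) ^ (2 * n - 5)"
    unfolding bin_gen_eq_sinh_cosh[OF assms(1)] K_def[symmetric]
    using K(1) by (simp add: norm_mult norm_power w_def)
  also have "\<dots> \<le> 2 * real n ^ 4 * 4 ^ n * (w ^ 3 * (3 / 2 + real n * w\<^sup>2))
      * (exp ((2 * real n - 5) * (sinh (Re s / 2))\<^sup>2) * exp (- (real n - 5 / 2) * w\<^sup>2))"
    using K by (intro mult_mono cosh_power bracket mult_nonneg_nonneg) (auto simp: w_def)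
  finally show ?thesis
    by (simp add: gaussian_profile_def mult_ac)
qed

lemma sinh_squared_le:
  fixes x :: real
  assumes "0 \<le> x" "x \<le> 1/100"
  shows "(sinh x)\<^sup>2 \<le> 51/50 * x\<^sup>2"
proof -
  have "exp x \<le> 1 + x + x\<^sup>2"
    using assms by (intro exp_bound) auto
  moreover have "1 + (- x) \<le> exp (- x)"
    by (rule exp_ge_add_one_self)
  moreover have "x\<^sup>2 \<le> x * (1/100)"
    unfolding power2_eq_square using assms by (intro mult_left_mono) auto
  ultimately have "sinh x \<le> 201/200 * x"
    by (simp add: sinh_field_def)
  hence "(sinh x)\<^sup>2 \<le> (201/200 * x)\<^sup>2"
    using assms(1) by (intro power_mono) auto
  also have "\<dots> \<le> 51/50 * x\<^sup>2"
    by (simp add: power_mult_distrib power_divide)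
  finally show ?thesis .
qed

lemma exp_51_25_le_8: "exp (51/25 :: real) \<le> 8"
proof -
  have "exp (51/25 :: real) = (exp 1)\<^sup>2 * exp (1/25)"
    by (simp flip: exp_double exp_add)
  also have "\<dots> \<le> (272/100)\<^sup>2 * (1 + 1/25 + (1/25)\<^sup>2)"
    using e_less_272 exp_bound[of "1/25"] by (intro mult_mono power_mono) auto
  also have "\<dots> \<le> 8"
    by (simp add: power2_eq_square)
  finally show ?thesis .
qed

lemma inverse_sqrt_le:
  assumes "n \<ge> 10000"
  shows "1 / sqrt (real n) \<le> 1/100"
proof -
  have "100 \<le> sqrt (real n)"
    using assms by (intro real_le_rsqrt) auto
  thus ?thesis
    by (simp add: divide_le_eq)
qed

lemma norm_bin_gen_on_line_le:
  fixes s :: complex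
  assumes "n \<ge> 10000" "Re s = 2 / sqrt (real n)"
  defines "w \<equiv> norm (sinh (s / 2))"
  shows "norm (bin_gen n s) \<le> 16 * 4 ^ n * (real n ^ 4 * gaussian_profile n w)"
proof -
  define a where "a = Re s / 2"
  have a_eq: "a = 1 / sqrt (real n)"
    using assms(2) by (simp add: a_def)
  hence "(sinh a)\<^sup>2 \<le> 51/50 * a\<^sup>2"
    using inverse_sqrt_le[OF assms(1)] by (intro sinh_squared_le) simp_all
  moreover have "a\<^sup>2 = 1 / real n"
    by (simp add: a_eq power_divide)
  ultimately have "(2 * real n - 5) * (sinh a)\<^sup>2 \<le> (2 * real n) * (51/50 * (1 / real n))"
    using assms(1) by (intro mult_mono) auto
  also have "\<dots> = 51/25"
    using assms(1) by simp
  finally have exp_le: "exp ((2 * real n - 5) * (sinh a)\<^sup>2) \<le> 8"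
    using exp_51_25_le_8 by (meson exp_le_cancel_iff order_trans)
  have "norm (bin_gen n s)
      \<le> 2 * real n ^ 4 * 4 ^ n * exp ((2 * real n - 5) * (sinh a)\<^sup>2) * gaussian_profile n w"
    unfolding w_def a_def using assms(1) by (intro norm_bin_gen_le) simp
  also have "\<dots> \<le> 2 * real n ^ 4 * 4 ^ n * 8 * gaussian_profile n w"
    using exp_le by (intro mult_right_mono mult_left_mono) (simp_all add: gaussian_profile_def w_def)
  finally show ?thesis
    by (simp add: mult_ac)
qed

lemma gaussian_moment_le:
  assumes "n \<ge> 10000" "k \<le> 11"
  shows "(real n * w\<^sup>2) ^ k * exp (- (real n - 5 / 2) * w\<^sup>2) \<le> 101 / 100 * fact k"
proof -
  define v where "v = real n - 5 / 2"
  have "v > 0" "real n \<le> (1 + 1 / 3000) * v"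
    using assms(1) by (simp_all add: v_def)
  have "real n ^ k \<le> ((1 + 1 / 3000) * v) ^ k"
    using \<open>real n \<le> (1 + 1 / 3000) * v\<close> by (intro power_mono) auto
  also have "\<dots> \<le> (1 + 1 / 3000) ^ 11 * v ^ k"
    unfolding power_mult_distrib using \<open>v > 0\<close> assms(2) by (intro mult_right_mono power_increasing) auto
  also have "\<dots> \<le> 101 / 100 * v ^ k"
    using \<open>v > 0\<close> by (intro mult_right_mono) (auto simp: eval_nat_numeral)
  finally have n_power: "real n ^ k \<le> 101 / 100 * v ^ k" .
  have "(real n * w\<^sup>2) ^ k * exp (- v * w\<^sup>2) = real n ^ k * ((w\<^sup>2) ^ k * exp (- (v * w\<^sup>2)))"
    by (simp add: power_mult_distrib)
  also have "\<dots> \<le> (101 / 100 * v ^ k) * (fact k / v ^ k)"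
    using \<open>v > 0\<close> by (intro mult_mono n_power power_times_exp_minus_le) auto
  also have "\<dots> = 101 / 100 * fact k"
    using \<open>v > 0\<close> by simp
  finally show ?thesis
    by (simp add: v_def)
qed

lemma norm_reduced_series_minus_trig_approx_on_line_le:
  fixes s :: complex
  assumes "n \<ge> 10000" "Re s = 2 / sqrt (real n)" "\<bar>Im s\<bar> \<le> pi"
  defines "w \<equiv> norm (sinh (s / 2))"
  shows "norm (reduced_series s - trig_approx s) \<le> 11 * w ^ 5 + 1 / 40 * (real n ^ 5 * w ^ 18)"
proof -
  have Re_s: "0 < Re s" "Re s \<le> 1/50"
    using inverse_sqrt_le[OF assms(1)] assms(1,2) by auto
  have "w \<ge> 0"
    by (simp add: w_def)
  have norm_s: "norm s \<le> pi * w"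
    unfolding w_def by (rule norm_le_pi_norm_sinh_half[OF assms(3)])
  have "norm s ^ 5 \<le> (pi * w) ^ 5"
    using norm_s by (intro power_mono) auto
  also have "\<dots> \<le> 3.1416 ^ 5 * w ^ 5"
    unfolding power_mult_distrib using pi_approx \<open>w \<ge> 0\<close> by (intro mult_right_mono power_mono) auto
  finally have fifth: "norm s ^ 5 / 29 \<le> 11 * w ^ 5"
    using zero_le_power[OF \<open>w \<ge> 0\<close>, of 5] by (simp add: eval_nat_numeral)
  have "(norm s / pi) ^ 18 \<le> w ^ 18"
    using norm_s by (intro power_mono) (simp_all add: divide_le_eq mult.commute)
  moreover have "sqrt (real n) ^ 10 = ((sqrt (real n))\<^sup>2) ^ 5"
    by (simp only: flip: power_mult) simp
  hence "Re s ^ 10 = 1024 / real n ^ 5"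
    by (simp add: assms(2) power_divide)
  ultimately have "24 * (norm s / pi) ^ 18 / Re s ^ 10 \<le> 24 / (1024 / real n ^ 5) * w ^ 18"
    by (simp add: mult_left_mono)
  also have "\<dots> \<le> 1 / 40 * (real n ^ 5 * w ^ 18)"
    using \<open>w \<ge> 0\<close> by (simp add: mult_right_mono)
  finally show ?thesis
    using norm_reduced_series_minus_trig_approx_le[OF Re_s assms(3)] fifth by linarith
qed

lemma gaussian_error_le:
  fixes w :: real
  assumes "n \<ge> 10000" "0 \<le> w" "w \<le> 2"
  shows "(11 * w ^ 5 + 1 / 40 * (real n ^ 5 * w ^ 18)) * (real n ^ 4 * gaussian_profile n w) \<le> 1968"
proof -
  define x where "x = real n * w\<^sup>2"
  define E where "E = exp (- (real n - 5 / 2) * w\<^sup>2)"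
  have moment: "x ^ k * E \<le> 101 / 100 * fact k" if "k \<le> 11" for k
    using gaussian_moment_le[OF assms(1) that, of w] by (simp add: x_def E_def)
  have w_power_8: "real n ^ 4 * (w ^ 5 * w ^ 3) = x ^ 4"
    by (simp add: x_def power_mult_distrib flip: power_mult power_add)
  have "x ^ 10 = real n * (real n ^ 5 * real n ^ 4) * w ^ 20"
    by (simp add: x_def power_mult_distrib flip: power_mult power_add power_Suc)
  moreover have "w ^ 18 * w ^ 3 = w * w ^ 20"
    by (simp flip: power_add power_Suc)
  ultimately have w_power_21: "real n ^ 5 * real n ^ 4 * (w ^ 18 * w ^ 3) = w / real n * x ^ 10"
    using assms(1) by simp
  have "(11 * w ^ 5 + 1 / 40 * (real n ^ 5 * w ^ 18)) * (real n ^ 4 * (w ^ 3 * (3 / 2 + x) * E))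
      = (11 * (real n ^ 4 * (w ^ 5 * w ^ 3)) + 1 / 40 * (real n ^ 5 * real n ^ 4 * (w ^ 18 * w ^ 3)))
        * ((3 / 2 + x) * E)"
    by (simp only: distrib_left distrib_right mult_ac)
  also have "\<dots> = 11 * (3 / 2 * (x ^ 4 * E) + x ^ 5 * E)
      + 1 / 40 * (w / real n) * (3 / 2 * (x ^ 10 * E) + x ^ 11 * E)"
  proof -
    have "x ^ 5 = x * x ^ 4" "x ^ 11 = x * x ^ 10"
      by (simp_all flip: power_Suc)
    thus ?thesis
      unfolding w_power_8 w_power_21 by (simp add: algebra_simps add_divide_distrib)
  qed
  also have "\<dots> \<le> 11 * 158 + 1 / 40 * (2 / 10000) * 46000000"
  proof (intro add_mono mult_mono)
    show "3 / 2 * (x ^ 4 * E) + x ^ 5 * E \<le> 158"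
      using moment[of 4] moment[of 5] by (simp add: fact_numeral)
    show "3 / 2 * (x ^ 10 * E) + x ^ 11 * E \<le> 46000000"
      using moment[of 10] moment[of 11] by (simp add: fact_numeral)
    show "w / real n \<le> 2 / 10000"
      using assms by (intro frac_le) auto
  qed (use assms(2) in \<open>simp_all add: x_def E_def\<close>)
  finally show ?thesis
    by (simp add: gaussian_profile_def x_def E_def)
qed

lemma norm_integrand_le:
  fixes s :: complex
  assumes "n \<ge> 10000" "Re s = 2 / sqrt (real n)" "\<bar>Im s\<bar> \<le> pi"
  shows "norm ((reduced_series s - trig_approx s) * bin_gen n s) \<le> 31500 * 4 ^ n"
proof -
  define w where "w = norm (sinh (s / 2))"
  have w: "0 \<le> w" "w \<le> 2"
    using inverse_sqrt_le[OF assms(1)] by (auto simp: w_def assms(2) intro!: norm_sinh_le_2)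
  have "norm ((reduced_series s - trig_approx s) * bin_gen n s)
      \<le> (11 * w ^ 5 + 1 / 40 * (real n ^ 5 * w ^ 18)) * (16 * 4 ^ n * (real n ^ 4 * gaussian_profile n w))"
    unfolding norm_mult w_def
    by (intro mult_mono norm_reduced_series_minus_trig_approx_on_line_le norm_bin_gen_on_line_le assms) auto
  also have "\<dots> = 16 * 4 ^ n
      * ((11 * w ^ 5 + 1 / 40 * (real n ^ 5 * w ^ 18)) * (real n ^ 4 * gaussian_profile n w))"
    by (simp only: mult_ac)
  also have "\<dots> \<le> 16 * 4 ^ n * 1968"
    by (intro mult_left_mono gaussian_error_le assms(1) w) simp
  also have "\<dots> \<le> 31500 * 4 ^ n"
    by simp
  finally show ?thesis .
qed

section \<open>The main estimate\<close>

lemma F_approximation: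
  assumes "n \<ge> 10000"
  shows "\<bar>real_of_int (F n) - main_combination n\<bar> \<le> 31500 * 4 ^ n"
proof -
  define s where "s = Complex (2 / sqrt (real n))"
  have "((\<lambda>t. reduced_series (s t) * bin_gen n (s t) - trig_approx (s t) * bin_gen n (s t)) has_integral
      (of_real (2 * pi * real_of_int (F n)) - of_real (2 * pi * main_combination n))) (cbox (- pi) pi)"
    unfolding s_def cbox_interval using assms
    by (intro has_integral_diff has_integral_reduced_series_times_bin_gen
        has_integral_trig_approx_times_bin_gen) auto
  moreover have "norm (reduced_series (s t) * bin_gen n (s t) - trig_approx (s t) * bin_gen n (s t))
      \<le> 31500 * 4 ^ n" if "t \<in> cbox (- pi) pi" for t
    unfolding left_diff_distrib[symmetric]
    by (rule norm_integrand_le[OF assms]) (use that in \<open>auto simp: s_def\<close>)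
  ultimately have "norm (complex_of_real (2 * pi * real_of_int (F n)) - of_real (2 * pi * main_combination n))
      \<le> 31500 * 4 ^ n * measure lborel (cbox (- pi) pi)"
    by (intro has_integral_bound) auto
  also have "complex_of_real (2 * pi * real_of_int (F n)) - of_real (2 * pi * main_combination n)
      = of_real (2 * pi * (real_of_int (F n) - main_combination n))"
    by (simp add: right_diff_distrib)
  finally have "(2 * pi) * \<bar>real_of_int (F n) - main_combination n\<bar> \<le> (2 * pi) * (31500 * 4 ^ n)"
    unfolding norm_of_real by (simp add: abs_mult mult_ac)
  thus ?thesis
    by (rule mult_left_le_imp_le) simp
qed

lemma main_combination_eq:
  assumes "n \<ge> 1"
  shows "main_combination n = real ((2 * n) choose n)
    * (- ((real n)\<^sup>2 / 8) + real n / 24 + real n * (4 * real n - 3) / (2 * (real n + 1) * (real n + 2)))"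
proof -
  define x b where "x = real n" and "b = real ((2 * n) choose n)"
  have x: "x + 1 \<noteq> 0" "x + 2 \<noteq> 0"
    by (simp_all add: x_def add_nonneg_eq_0_iff)
  have choose_1: "real (central_choose n 1) = x / (x + 1) * b"
    using central_choose_Suc[of n 0] x by (simp add: central_choose_def b_def x_def field_simps)
  have choose_2: "real (central_choose n 2) = (x - 1) / (x + 2) * (x / (x + 1) * b)"
    using central_choose_Suc[of n 1] x unfolding choose_1[symmetric] by (simp add: x_def field_simps)
  have weight_1: "bin_weight n 1 = 3 * (x - 1) * (x - 2) * (x / (x + 1) * b)"
    unfolding choose_1[symmetric] bin_weight_def by (simp add: x_def algebra_simps)
  have weight_2: "bin_weight n 2 = 6 * (x - 2) * (x - 8) * ((x - 1) / (x + 2) * (x / (x + 1) * b))"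
    unfolding choose_2[symmetric] bin_weight_def by (simp add: x_def algebra_simps)
  show ?thesis
    unfolding main_combination_def weight_1 weight_2 x_def[symmetric] b_def[symmetric]
    using x by (simp add: divide_simps) (simp add: algebra_simps power2_eq_square)
qed

lemma F_over_central_binomial:
  assumes "n \<ge> 10000"
  shows "\<bar>real_of_int (F n) / real ((2 * n) choose n) - (- ((real n)\<^sup>2 / 8) + real n / 24)\<bar>
           \<le> 63000 * sqrt (real n) + 2"
proof -
  define b where "b = real ((2 * n) choose n)"
  define r where "r = real n * (4 * real n - 3) / (2 * (real n + 1) * (real n + 2))"
  define M where "M = - ((real n)\<^sup>2 / 8) + real n / 24"
  have "b > 0"
    by (simp add: b_def)
  have "real n * (4 * real n - 3) \<le> 2 * (2 * (real n + 1) * (real n + 2))"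
    by (simp add: algebra_simps)
  hence "\<bar>r\<bar> \<le> 2"
    using assms by (simp add: r_def divide_le_eq)
  have "\<bar>real_of_int (F n) / b - M - r\<bar> = \<bar>real_of_int (F n) - b * (M + r)\<bar> / b"
    using \<open>b > 0\<close> by (simp add: abs_div_pos diff_divide_distrib diff_diff_eq)
  also have "\<dots> \<le> 31500 * 4 ^ n / b"
    using F_approximation[OF assms] main_combination_eq[of n] assms \<open>b > 0\<close>
    by (intro divide_right_mono) (simp_all add: b_def M_def r_def)
  also have "\<dots> \<le> 31500 * (2 * sqrt (real n) * b) / b"
    using central_binomial_ge[of n] assms \<open>b > 0\<close>
    by (intro divide_right_mono mult_left_mono) (simp_all add: b_def)
  also have "\<dots> = 63000 * sqrt (real n)"
    using \<open>b > 0\<close> by simp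
  finally show ?thesis
    using \<open>\<bar>r\<bar> \<le> 2\<close> unfolding b_def[symmetric] M_def[symmetric] by linarith
qed

theorem mainTheorem1:
  fixes n :: nat
  assumes "n \<ge> 10000"
  shows "\<bar>real_of_int (F n) / real ((2 * n) choose n) - (- ((real n)\<^sup>2 / 8) + real n / 24)\<bar>
           \<le> 38755553 / 5000 * real n powr (3 / 4)"
proof -
  define q where "q = real n powr (1 / 4)"
  have "(10 ^ 4) powr (1 / 4) \<le> q"
    unfolding q_def using assms by (intro powr_mono2) auto
  hence "10 \<le> q"
    by (simp add: powr_powr flip: powr_realpow)
  have powers: "sqrt (real n) = q\<^sup>2" "real n powr (3 / 4) = q ^ 3"
    using assms by (simp_all add: q_def powr_half_sqrt[symmetric] powr_powr flip: powr_realpow)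
  have "63000 * q\<^sup>2 + 2 \<le> 63000 * (q ^ 3 / 10) + q ^ 3"
  proof (intro add_mono mult_left_mono)
    show "q\<^sup>2 \<le> q ^ 3 / 10"
      using mult_right_mono[OF \<open>10 \<le> q\<close>, of "q\<^sup>2"] by (simp add: power3_eq_cube power2_eq_square)
    show "2 \<le> q ^ 3"
      using power_mono[OF \<open>10 \<le> q\<close>, of 3] by simp
  qed simp
  also have "\<dots> \<le> 38755553 / 5000 * q ^ 3"
    using \<open>10 \<le> q\<close> by simp
  finally show ?thesis
    using F_over_central_binomial[OF assms] unfolding powers by linarith
qed

end
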